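(* Let $T$ be a tree of order $n\ge 8$ and let $e$ be a non-pendent edge of $T$. Let $T_1$ and $T_2$ be the two components of $T-e$, of orders $n_1$ and $n_2$ respectively. For $i=1,2$, let $k_i$ be the number of Laplacian eigenvalues of $T_i$ that are greater than or equal to the average degree $\overline{d}(T-e)=2-\frac{4}{n}$ of $T-e$, and let $\sigma_i$ be the number of Laplacian eigenvalues of $T_i$ that are greater than or equal to the average degree $\overline{d}(T_i)=2-\frac{2}{n_i}$ of $T_i$. If $\sigma_1=k_1$, $\sigma_2=k_2$, and $$LE(T_i)\ge 2+\frac{4n_i}{\pi}\quad\text{for } i=1,2,$$ then $LE(T)\ge LE(P_n)$, where $P_n$ is the path on $n$ vertices.
   Context: For a simple graph $G$ with $n$ vertices and $m$ edges, let $L(G)=D(G)-A(G)$ be its Laplacian matrix ($D(G)$ the diagonal matrix of vertex degrees, $A(G)$ the adjacency matrix), with eigenvalues (the Laplacian eigenvalues of $G$) $\mu_1(G)\ge\mu_2(G)\ge\dots\ge\mu_n(G)=0$. The average degree is $\overline{d}(G)=\frac{2m}{n}$. The Laplacian energy is $LE(G)=\sum_{i=1}^{n}\left|\mu_i(G)-\overline{d}(G)\right|$. Eigenvalues are always counted with multiplicity. An edge is non-pendent if neither of its endpoints has degree $1$; $T-e$ is the graph obtained from $T$ by deleting the edge $e$ and keeping all vertices. *)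

theory Defs
  imports "Jordan_Normal_Form.Char_Poly" "Graph_Theory.Digraph_Component"
begin

text \<open>
  A simple graph is a \<^locale>\<open>graph\<close> of the library, i.e. a finite, loopless symmetric digraph
  without parallel arcs: each undirected edge is represented by two opposite arcs. Hence the degree
  of a vertex is its out-degree, and an edge may be named by either of its two arcs.
\<close>

abbreviation degree_of :: "('a,'b) pre_digraph \<Rightarrow> 'a \<Rightarrow> nat" where
  "degree_of G v \<equiv> out_degree G v"

definition undirected_edges :: "('a,'b) pre_digraph \<Rightarrow> 'a set set" where
  "undirected_edges G = (\<lambda>a. {tail G a, head G a}) ` arcs G"

text \<open>
  The library's \<open>tree\<close> cannot be used here: its cycles are directed, so that in a symmetric digraph
  an arc followed by its reverse is already a cycle. In a simple graph, the directed cycles of length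
  at least 3 are exactly the traversals of undirected cycles.
\<close>

definition undirected_tree :: "('a,'b) pre_digraph \<Rightarrow> bool" where
  "undirected_tree G \<longleftrightarrow> Digraph.graph G \<and> Digraph_Component.connected G \<and>
     \<not> (\<exists>p. pre_digraph.cycle G p \<and> 3 \<le> length p)"

definition delete_edge :: "('a,'b) pre_digraph \<Rightarrow> 'b \<Rightarrow> ('a,'b) pre_digraph" where
  "delete_edge G e =
     G\<lparr>arcs := {a \<in> arcs G. {tail G a, head G a} \<noteq> {tail G e, head G e}}\<rparr>"

definition non_pendent :: "('a,'b) pre_digraph \<Rightarrow> 'b \<Rightarrow> bool" where
  "non_pendent G e \<longleftrightarrow> degree_of G (tail G e) \<noteq> 1 \<and> degree_of G (head G e) \<noteq> 1"

definition components :: "('a,'b) pre_digraph \<Rightarrow> ('a,'b) pre_digraph set" where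
  "components G = {H. pre_digraph.max_subgraph G Digraph_Component.connected H}"

definition path_graph :: "nat \<Rightarrow> (nat, nat \<times> nat) pre_digraph" where
  "path_graph n = \<lparr>verts = {..<n},
     arcs = {(i, j). i < n \<and> j < n \<and> (j = Suc i \<or> i = Suc j)}, tail = fst, head = snd\<rparr>"

definition average_degree :: "('a,'b) pre_digraph \<Rightarrow> real" where
  "average_degree G = 2 * real (card (undirected_edges G)) / real (card (verts G))"

text \<open>
  Matrix indices are natural numbers, so the degree, adjacency and Laplacian matrices depend on an
  enumeration of the vertices; the characteristic polynomial of the Laplacian matrix does not,
  as proved below.
\<close>

definition degree_matrix :: "('a,'b) pre_digraph \<Rightarrow> 'a list \<Rightarrow> real mat" where
  "degree_matrix G vs = mat (length vs) (length vs)
     (\<lambda>(i, j). if i = j then real (degree_of G (vs ! i)) else 0)"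

definition adjacency_matrix :: "('a,'b) pre_digraph \<Rightarrow> 'a list \<Rightarrow> real mat" where
  "adjacency_matrix G vs = mat (length vs) (length vs)
     (\<lambda>(i, j). if (vs ! i, vs ! j) \<in> arcs_ends G then 1 else 0)"

definition laplacian_matrix :: "('a,'b) pre_digraph \<Rightarrow> 'a list \<Rightarrow> real mat" where
  "laplacian_matrix G vs = degree_matrix G vs - adjacency_matrix G vs"

definition vertex_enum :: "('a,'b) pre_digraph \<Rightarrow> 'a list" where
  "vertex_enum G = (SOME vs. distinct vs \<and> set vs = verts G)"

lemma char_poly_laplacian_matrix_enum:
  assumes "distinct vs" "distinct ws" "set vs = set ws"
  shows "char_poly (laplacian_matrix G vs) = char_poly (laplacian_matrix G ws)"
proof -
  define n where "n = length ws"
  have "mset vs = mset ws"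
    using assms set_eq_iff_mset_eq_distinct by blast
  then obtain p where p: "p permutes {..<length ws}" and pl: "permute_list p ws = vs"
    by (rule mset_eq_permutation)
  have pn: "p permutes {0..<n}" using p by (simp add: n_def atLeast0LessThan)
  have len: "length vs = n" using pl by (auto simp: n_def)
  have nth: "vs ! i = ws ! p i" if "i < n" for i
    using that permute_list_nth[OF p, of i] pl by (simp add: n_def)
  have bound: "p i < n" if "i < n" for i
    using permutes_in_image[OF pn, of i] that by simp
  have inj: "p i = p j \<longleftrightarrow> i = j" for i j
    using permutes_inj[OF pn] by (auto dest: injD)
  have ws: "length ws = n" by (simp add: n_def)
  define A where "A = char_poly_matrix (laplacian_matrix G ws)"
  define B where "B = mat n n (\<lambda>(i, j). A $$ (p i, j))"
  have A: "A \<in> carrier_mat n n"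
    by (auto simp: A_def char_poly_matrix_def laplacian_matrix_def degree_matrix_def
        adjacency_matrix_def n_def)
  have B: "B \<in> carrier_mat n n" by (simp add: B_def)
  have eq: "char_poly_matrix (laplacian_matrix G vs) = mat n n (\<lambda>(i, j). A $$ (p i, p j))"
    by (rule eq_matI)
      (auto simp: A_def char_poly_matrix_def laplacian_matrix_def degree_matrix_def
        adjacency_matrix_def len ws nth bound inj)
  have tr: "mat n n (\<lambda>(i, j). A $$ (p i, p j)) =
      transpose_mat (mat n n (\<lambda>(i, j). transpose_mat B $$ (p i, j)))"
    by (rule eq_matI) (auto simp: B_def bound)
  have "char_poly (laplacian_matrix G vs) =
      det (mat n n (\<lambda>(i, j). transpose_mat B $$ (p i, j)))"
    unfolding char_poly_def eq tr by (rule det_transpose[of _ n]) simp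
  also have "\<dots> = signof p * det (transpose_mat B)"
    by (rule det_permute_rows[OF _ pn]) (use B in simp)
  also have "\<dots> = signof p * (signof p * det A)"
    using det_permute_rows[OF A pn] by (simp add: det_transpose[OF B] flip: B_def)
  also have "\<dots> = char_poly (laplacian_matrix G ws)"
    by (simp add: sign_def char_poly_def A_def flip: mult.assoc)
  finally show ?thesis .
qed

text \<open>
  The multiset of Laplacian eigenvalues, each repeated according to its multiplicity as a root of
  the characteristic polynomial. This symmetric matrix has real eigenvalues only, so the real roots
  are all the roots.
\<close>

definition laplacian_eigenvalues :: "('a,'b) pre_digraph \<Rightarrow> real multiset" where
  "laplacian_eigenvalues G = proots (char_poly (laplacian_matrix G (vertex_enum G)))"

definition num_laplacian_eigenvalues_ge :: "('a,'b) pre_digraph \<Rightarrow> real \<Rightarrow> nat" where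
  "num_laplacian_eigenvalues_ge G c = size {#\<mu> \<in># laplacian_eigenvalues G. c \<le> \<mu>#}"

definition laplacian_energy :: "('a,'b) pre_digraph \<Rightarrow> real" where
  "laplacian_energy G = (\<Sum>\<mu>\<in>#laplacian_eigenvalues G. \<bar>\<mu> - average_degree G\<bar>)"

end

theory Submission
  imports Defs
begin

text \<open>
  Let \<open>d\<close> and \<open>d\<^sub>i\<close> be the average degrees of \<open>T\<close> and \<open>T\<^sub>i\<close>. Since the Laplacian eigenvalues sum to
  \<open>n d\<close>, the energy is \<open>2 \<Sum> max(\<mu> - d, 0)\<close>, which dominates \<open>2 \<Sum>\<^sub>j (\<langle>x\<^sub>j, L x\<^sub>j\<rangle> - d)\<close> for every
  orthonormal family \<open>x\<^sub>j\<close>. Take for \<open>x\<^sub>j\<close> the eigenvectors of \<open>T\<^sub>1\<close> and \<open>T\<^sub>2\<close> with eigenvalue at least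
  \<open>d\<^sub>i\<close>, extended by zero: adding edges only increases the quadratic form, there are at most \<open>n\<^sub>i\<close> of
  them, and \<open>d\<^sub>i - d = 2/n - 2/n\<^sub>i\<close>, so \<open>LE(T) \<ge> LE(T\<^sub>1) + LE(T\<^sub>2) - 4 \<ge> 4n/\<pi>\<close>. On the other hand the
  eigenvalues \<open>2 - 2 cos(\<pi>j/n)\<close> of the path give \<open>LE(P\<^sub>n) = 2 cot(\<pi>/2n)\<close> for even \<open>n\<close> and
  \<open>LE(P\<^sub>n) = 2/sin(\<pi>/2n) - 2/n\<close> for odd \<open>n\<close>, both at most \<open>4n/\<pi>\<close>.
\<close>

section \<open>Orthogonal diagonalization of real symmetric matrices\<close>

text \<open>A complex eigenvalue \<open>c\<close> exists by the fundamental theorem of algebra.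
  Symmetry makes the Hermitian form of an eigenvector real, which forces \<open>c\<close> to be
  real, and a real root of the characteristic polynomial has a real eigenvector.\<close>

lemma symmetric_real_has_eigenvector:
  fixes A :: "real mat"
  assumes A: "A \<in> carrier_mat n n" and sym: "transpose_mat A = A" and n: "0 < n"
  obtains e v where "v \<in> carrier_vec n" "v \<noteq> 0\<^sub>v n" "A *\<^sub>v v = e \<cdot>\<^sub>v v"
proof -
  let ?C = "map_mat complex_of_real A"
  have C: "?C \<in> carrier_mat n n" using A by simp
  obtain c where c: "eigenvalue ?C c"
  proof -
    have "degree (char_poly ?C) = n" using degree_monic_char_poly[OF C] by simp
    then have "\<not> constant (poly (char_poly ?C))" using n by (simp add: constant_degree)
    then obtain c where "poly (char_poly ?C) c = 0"
      using fundamental_theorem_of_algebra by blast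
    then show ?thesis using that eigenvalue_root_char_poly[OF C] by blast
  qed
  then obtain v where v: "v \<in> carrier_vec n" "v \<noteq> 0\<^sub>v n" "?C *\<^sub>v v = c \<cdot>\<^sub>v v"
    using C by (auto simp: eigenvalue_def eigenvector_def)
  have Cv: "(\<Sum>j<n. of_real (A $$ (i,j)) * v $ j) = c * v $ i" if "i < n" for i
  proof -
    have "(?C *\<^sub>v v) $ i = (\<Sum>j<n. of_real (A $$ (i,j)) * v $ j)"
      using that A v(1) by (auto simp: scalar_prod_def lessThan_atLeast0 intro!: sum.cong)
    then show ?thesis using v that by simp
  qed
  have symE: "A $$ (i,j) = A $$ (j,i)" if "i < n" "j < n" for i j
  proof -
    have "A $$ (i,j) = transpose_mat A $$ (i,j)" by (simp add: sym)
    then show ?thesis using that A by simp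
  qed
  \<comment> \<open>The value \<open>q\<close> of the form is computed twice: the eigenvalue
    equation gives \<open>c * r\<close>, and swapping the two sums gives \<open>cnj q = q\<close>.
    As \<open>r\<close> is positive, \<open>c\<close> must equal its conjugate.\<close>
  define q where "q = (\<Sum>i<n. \<Sum>j<n. cnj (v $ i) * of_real (A $$ (i,j)) * v $ j)"
  define r where "r = (\<Sum>i<n. (cmod (v $ i))\<^sup>2)"
  have "q = (\<Sum>i<n. cnj (v $ i) * (c * v $ i))"
    unfolding q_def by (auto simp: Cv[symmetric] sum_distrib_left mult.assoc intro!: sum.cong)
  also have "\<dots> = c * of_real r"
    unfolding r_def of_real_sum sum_distrib_left
    by (intro sum.cong) (auto simp: complex_norm_square mult_ac simp del: of_real_power)
  finally have q: "q = c * of_real r" .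
  have "cnj q = (\<Sum>i<n. \<Sum>j<n. v $ i * of_real (A $$ (i,j)) * cnj (v $ j))"
    by (simp add: q_def)
  also have "\<dots> = (\<Sum>j<n. \<Sum>i<n. v $ i * of_real (A $$ (i,j)) * cnj (v $ j))"
    by (rule sum.swap)
  also have "\<dots> = q"
    unfolding q_def by (intro sum.cong refl) (simp add: symE mult_ac)
  finally have "cnj q = q" .
  moreover have "r \<noteq> 0"
  proof
    assume "r = 0"
    then have "\<forall>i<n. v $ i = 0" unfolding r_def by (subst (asm) sum_nonneg_eq_0_iff) auto
    then have "v = 0\<^sub>v n" using v(1) by (intro eq_vecI) auto
    with v(2) show False by simp
  qed
  ultimately have "cnj c = c" using q by auto
  then have cr: "c = of_real (Re c)" by (simp add: complex_eq_iff)
  have "poly (map_poly of_real (char_poly A)) c = 0"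
    using c eigenvalue_root_char_poly[OF C] of_real_hom.char_poly_hom[OF A] by metis
  then have "complex_of_real (poly (char_poly A) (Re c)) = 0"
    by (subst (asm) cr) (simp only: of_real_hom.poly_map_poly)
  then have "eigenvalue A (Re c)" using eigenvalue_root_char_poly[OF A] by simp
  then show ?thesis using that A by (auto simp: eigenvalue_def eigenvector_def)
qed

text \<open>The reflection in the hyperplane orthogonal to \<open>w = v - e\<close>, where
  \<open>e\<close> is the first unit vector, exchanges the unit vectors \<open>e\<close> and
  \<open>v\<close>.\<close>

lemma householder_reflection:
  fixes v :: "real vec"
  assumes v: "v \<in> carrier_vec n" "v \<bullet> v = 1" and n: "0 < n"
  obtains H where "H \<in> carrier_mat n n" "transpose_mat H = H" "H * H = 1\<^sub>m n" "H *\<^sub>v unit_vec n 0 = v"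
proof -
  define w where "w i = v $ i - (if i = 0 then 1 else 0)" for i
  define s where "s = (\<Sum>i<n. (w i)\<^sup>2)"
  \<comment> \<open>If \<open>v\<close> is already the first unit vector, then \<open>s = 0\<close>,
    so \<open>c = 2 / 0 = 0\<close> and \<open>H\<close> is the identity; the fact \<open>cs\<close>
    below covers this case as well.\<close>
  define c where "c = 2 / s"
  have vv: "(\<Sum>i<n. (v $ i)\<^sup>2) = 1"
    using v by (simp add: scalar_prod_def lessThan_atLeast0 power2_eq_square)
  have "s = (\<Sum>i<n. (v $ i)\<^sup>2 + (if i = 0 then 1 - 2 * v $ 0 else 0))"
    unfolding s_def w_def by (intro sum.cong) (auto simp: power2_eq_square algebra_simps)
  also have "\<dots> = 2 - 2 * v $ 0" using n by (simp add: sum.distrib vv)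
  finally have s: "s = - 2 * w 0" by (simp add: w_def)
  have w0: "w i = 0" if "s = 0" "i < n" for i
    using that unfolding s_def by (subst (asm) sum_nonneg_eq_0_iff) auto
  have cs: "c * s * w i = 2 * w i" if "i < n" for i
    using w0[OF _ that] by (cases "s = 0") (auto simp: c_def)
  define H where "H = mat n n (\<lambda>(i,j). (if i = j then 1 else 0) - c * w i * w j)"
  have H: "H \<in> carrier_mat n n" by (simp add: H_def)
  moreover have "transpose_mat H = H" by (rule eq_matI) (auto simp: H_def)
  moreover have "H * H = 1\<^sub>m n"
  proof (rule eq_matI)
    fix i j assume "i < dim_row (1\<^sub>m n)" "j < dim_col (1\<^sub>m n)"
    then have ij: "i < n" "j < n" by auto
    have "(H * H) $$ (i,j) = (\<Sum>k<n. ((if i = k then 1 else 0) - c * w i * w k) * ((if k = j then 1 else 0) - c * w k * w j))"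
      using ij by (simp add: H_def scalar_prod_def lessThan_atLeast0)
    also have "\<dots> = (\<Sum>k<n. (if i = k then (if i = j then 1 else 0) - c * w i * w j else 0)
        - (if k = j then c * w i * w j else 0) + c * w j * c * w i * (w k)\<^sup>2)"
      by (intro sum.cong) (auto simp: algebra_simps power2_eq_square)
    also have "\<dots> = (if i = j then 1 else 0) - 2 * (c * w i * w j) + c * w j * (c * s * w i)"
      using ij by (simp add: sum.distrib sum_subtractf s_def sum_distrib_left[symmetric])
    also have "\<dots> = (if i = j then 1 else 0)" using cs[OF ij(1)] by simp
    finally show "(H * H) $$ (i,j) = 1\<^sub>m n $$ (i,j)" using ij by simp
  qed (auto simp: H_def)
  moreover have "H *\<^sub>v unit_vec n 0 = v"
  proof (rule eq_vecI)
    fix i assume "i < dim_vec v"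
    then have i: "i < n" using v by simp
    have "(H *\<^sub>v unit_vec n 0) $ i = H $$ (i, 0)"
      using i n H by (simp add: scalar_prod_right_unit)
    also have "\<dots> = (if i = 0 then 1 else 0) + w i"
      using i n cs[OF i] by (auto simp: H_def s mult_ac)
    finally show "(H *\<^sub>v unit_vec n 0) $ i = v $ i" by (simp add: w_def)
  qed (use v H in auto)
  ultimately show ?thesis using that by blast
qed

text \<open>Deflation by induction on the dimension: a reflection moves a unit eigenvector to the
  first coordinate axis, symmetry clears the first row along with the first column, and the
  induction hypothesis handles the remaining block.\<close>

lemma real_symmetric_diagonalization:
  fixes A :: "real mat"
  assumes "A \<in> carrier_mat n n" and "transpose_mat A = A"
  shows "\<exists>U f. U \<in> carrier_mat n n \<and> transpose_mat U * U = 1\<^sub>m n \<and> U * transpose_mat U = 1\<^sub>m n \<and>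
    A = U * mat_diag n f * transpose_mat U"
  using assms
proof (induction n arbitrary: A)
  case 0
  then show ?case by (intro exI[of _ "1\<^sub>m 0"] exI[of _ "\<lambda>_. 0"]) auto
next
  case (Suc m)
  let ?n = "Suc m"
  note A = Suc.prems(1)
  obtain e v where v: "v \<in> carrier_vec ?n" "v \<noteq> 0\<^sub>v ?n" "A *\<^sub>v v = e \<cdot>\<^sub>v v"
    by (rule symmetric_real_has_eigenvector[OF Suc.prems]) auto
  define u where "u = (1 / sqrt (v \<bullet> v)) \<cdot>\<^sub>v v"
  have vpos: "v \<bullet> v > 0"
    using v(1,2) conjugate_square_greater_0_vec[of v ?n] by simp
  have u: "u \<in> carrier_vec ?n" "A *\<^sub>v u = e \<cdot>\<^sub>v u"
    using v A by (auto simp: u_def mult_mat_vec smult_smult_assoc mult.commute)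
  have uu: "u \<bullet> u = 1"
    using v(1) vpos by (simp add: u_def field_simps)
  obtain H where H: "H \<in> carrier_mat ?n ?n" "transpose_mat H = H" "H * H = 1\<^sub>m ?n"
      "H *\<^sub>v unit_vec ?n 0 = u"
    using householder_reflection[OF u(1) uu] by auto
  define M where "M = H * A * H"
  have M: "M \<in> carrier_mat ?n ?n" using H A by (simp add: M_def)
  have symM: "transpose_mat M = M"
    using H A Suc.prems(2) by (simp add: M_def transpose_mult[of _ ?n ?n _ ?n] assoc_mult_mat[of _ ?n ?n _ ?n _ ?n])
  have "M *\<^sub>v unit_vec ?n 0 = H *\<^sub>v (A *\<^sub>v (H *\<^sub>v unit_vec ?n 0))"
    using H A by (simp add: M_def assoc_mult_mat_vec[of _ ?n ?n _ ?n])
  also have "\<dots> = e \<cdot>\<^sub>v (H *\<^sub>v (H *\<^sub>v unit_vec ?n 0))"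
    using H u by (simp add: mult_mat_vec)
  also have "H *\<^sub>v (H *\<^sub>v unit_vec ?n 0) = unit_vec ?n 0"
    using H by (subst assoc_mult_mat_vec[symmetric]) auto
  finally have Me: "M *\<^sub>v unit_vec ?n 0 = e \<cdot>\<^sub>v unit_vec ?n 0" .
  have col0: "M $$ (i, 0) = (if i = 0 then e else 0)" if "i < ?n" for i
  proof -
    have "(M *\<^sub>v unit_vec ?n 0) $ i = M $$ (i, 0)" using M that by (simp add: scalar_prod_right_unit)
    then show ?thesis using that unfolding Me by (auto split: if_splits)
  qed
  have symE: "M $$ (i,j) = M $$ (j,i)" if "i < ?n" "j < ?n" for i j
  proof -
    have "M $$ (i,j) = transpose_mat M $$ (i,j)" by (simp add: symM)
    then show ?thesis using that M by simp
  qed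
  define B where "B = mat m m (\<lambda>(i,j). M $$ (Suc i, Suc j))"
  have B: "B \<in> carrier_mat m m" by (simp add: B_def)
  have "transpose_mat B = B" by (rule eq_matI) (auto simp: B_def symE)
  from Suc.IH[OF B this] obtain V f where V: "V \<in> carrier_mat m m" "transpose_mat V * V = 1\<^sub>m m"
    "V * transpose_mat V = 1\<^sub>m m" "B = V * mat_diag m f * transpose_mat V" by blast
  define g where "g i = (case i of 0 \<Rightarrow> e | Suc k \<Rightarrow> f k)" for i
  let ?F = "four_block_mat (1\<^sub>m 1) (0\<^sub>m 1 m) (0\<^sub>m m 1) V"
  let ?Ft = "four_block_mat (1\<^sub>m 1) (0\<^sub>m 1 m) (0\<^sub>m m 1) (transpose_mat V)"
  let ?D = "four_block_mat (mat 1 1 (\<lambda>_. e)) (0\<^sub>m 1 m) (0\<^sub>m m 1) (mat_diag m f)"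
  have F: "?F \<in> carrier_mat ?n ?n" "?Ft \<in> carrier_mat ?n ?n"
    using V by auto
  have Ft: "transpose_mat ?F = ?Ft"
    using V by (subst transpose_four_block_mat) auto
  have one: "four_block_mat (1\<^sub>m 1) (0\<^sub>m 1 m) (0\<^sub>m m 1) (1\<^sub>m m) = 1\<^sub>m ?n"
    by (simp add: four_block_one_mat)
  have FF: "?F * ?Ft = 1\<^sub>m ?n" "?Ft * ?F = 1\<^sub>m ?n"
    using V by (simp_all add: mult_four_block_mat[of _ 1 1 _ m _ m _ _ 1 _ m] one)
  have D: "?D = mat_diag ?n g"
    by (rule eq_matI) (auto simp: g_def mat_diag_def split: nat.splits)
  have "?F * ?D * ?Ft = four_block_mat (mat 1 1 (\<lambda>_. e)) (0\<^sub>m 1 m) (0\<^sub>m m 1) B"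
    using V(1) mat_diag_dim[of m f] mult_carrier_mat[OF V(1) mat_diag_dim[of m f]] B
    unfolding V(4)
    by (simp add: mult_four_block_mat[of _ 1 1 _ m _ m _ _ 1 _ m] left_mult_zero_mat[of _ m m]
        right_mult_zero_mat[of _ m m] left_add_zero_mat[of _ m m])
  also have "\<dots> = M"
  proof (rule eq_matI)
    fix i j assume "i < dim_row M" "j < dim_col M"
    then have ij: "i < ?n" "j < ?n" using M by auto
    then show "four_block_mat (mat 1 1 (\<lambda>_. e)) (0\<^sub>m 1 m) (0\<^sub>m m 1) B $$ (i,j) = M $$ (i,j)"
      using col0[OF ij(1)] col0[OF ij(2)] symE[of 0 j]
      by (cases i; cases j) (auto simp: B_def)
  qed (use M in \<open>auto simp: B_def\<close>)
  finally have MD: "M = ?F * mat_diag ?n g * ?Ft" unfolding D by (rule sym)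
  define P P' where "P = ?F" and "P' = ?Ft"
  note P = F[folded P_def P'_def] Ft[folded P_def P'_def] FF[folded P_def P'_def]
  define E where "E = mat_diag ?n g"
  have E: "E \<in> carrier_mat ?n ?n" by (simp add: E_def)
  note MD = MD[folded P_def P'_def E_def]
  define U where "U = H * P"
  have U: "U \<in> carrier_mat ?n ?n" using H P by (simp add: U_def)
  have Ut: "transpose_mat U = P' * H"
    unfolding U_def transpose_mult[OF H(1) P(1)] by (simp add: H P)
  have "U * transpose_mat U = H * (P * P') * H"
    unfolding Ut unfolding U_def using H(1) P(1,2) by (simp add: assoc_mult_mat[of _ ?n ?n _ ?n _ ?n])
  then have 1: "U * transpose_mat U = 1\<^sub>m ?n" using H by (simp add: P)
  have "transpose_mat U * U = P' * (H * H) * P"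
    unfolding Ut unfolding U_def using H(1) P(1,2) by (simp add: assoc_mult_mat[of _ ?n ?n _ ?n _ ?n])
  then have 2: "transpose_mat U * U = 1\<^sub>m ?n" using H P by (simp add: P)
  have "U * E * transpose_mat U = H * M * H"
    unfolding Ut unfolding U_def MD using H(1) P(1,2) E by (simp add: assoc_mult_mat[of _ ?n ?n _ ?n _ ?n])
  also have "\<dots> = (H * H) * A * (H * H)"
    unfolding M_def using H(1) A by (simp add: assoc_mult_mat[of _ ?n ?n _ ?n _ ?n])
  also have "\<dots> = A" using A by (simp add: H)
  finally show ?case using U 1 2 unfolding E_def by metis
qed

section \<open>Laplacian eigenvectors and energy\<close>

text \<open>This is the product of D - A with a vertex function, with the degree term spread over
  the neighbours. It needs no enumeration of the vertices.\<close>

definition laplacian_op :: "('a,'b) pre_digraph \<Rightarrow> ('a \<Rightarrow> real) \<Rightarrow> 'a \<Rightarrow> real" where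
  "laplacian_op G x v = (\<Sum>w | (v, w) \<in> arcs_ends G. x v - x w)"

text \<open>Both orthogonality relations of an orthogonal matrix are recorded. The second one is
  completeness: it expands any vertex function in the basis without a dimension argument.\<close>

definition laplacian_eigenbasis :: "('a,'b) pre_digraph \<Rightarrow> (nat \<Rightarrow> real) \<Rightarrow> (nat \<Rightarrow> 'a \<Rightarrow> real) \<Rightarrow> bool" where
  "laplacian_eigenbasis G \<mu> u \<longleftrightarrow>
    (\<forall>i<card (verts G). \<forall>j<card (verts G). (\<Sum>v\<in>verts G. u i v * u j v) = (if i = j then 1 else 0)) \<and>
    (\<forall>v\<in>verts G. \<forall>w\<in>verts G. (\<Sum>i<card (verts G). u i v * u i w) = (if v = w then 1 else 0)) \<and>
    (\<forall>i<card (verts G). \<forall>v\<in>verts G. laplacian_op G (u i) v = \<mu> i * u i v) \<and>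
    laplacian_eigenvalues G = image_mset \<mu> (mset_set {..<card (verts G)})"

lemma laplacian_eigenbasisD:
  assumes "laplacian_eigenbasis G \<mu> u"
  shows "\<And>i j. i < card (verts G) \<Longrightarrow> j < card (verts G) \<Longrightarrow>
      (\<Sum>v\<in>verts G. u i v * u j v) = (if i = j then 1 else 0)"
    and "\<And>v w. v \<in> verts G \<Longrightarrow> w \<in> verts G \<Longrightarrow>
      (\<Sum>i<card (verts G). u i v * u i w) = (if v = w then 1 else 0)"
    and "\<And>i v. i < card (verts G) \<Longrightarrow> v \<in> verts G \<Longrightarrow> laplacian_op G (u i) v = \<mu> i * u i v"
    and "laplacian_eigenvalues G = image_mset \<mu> (mset_set {..<card (verts G)})"
  using assms unfolding laplacian_eigenbasis_def by blast+

lemma vertex_enum: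
  assumes "finite (verts G)"
  shows "distinct (vertex_enum G)" "set (vertex_enum G) = verts G"
proof -
  have "\<exists>vs. distinct vs \<and> set vs = verts G"
    using finite_distinct_list[OF assms] by auto
  then have "distinct (vertex_enum G) \<and> set (vertex_enum G) = verts G"
    unfolding vertex_enum_def by (rule someI_ex)
  then show "distinct (vertex_enum G)" "set (vertex_enum G) = verts G" by auto
qed

lemma proots_char_poly_orthogonally_diagonalized:
  fixes A :: "real mat"
  assumes A: "A \<in> carrier_mat n n" and U: "U \<in> carrier_mat n n"
    and UU: "transpose_mat U * U = 1\<^sub>m n" "U * transpose_mat U = 1\<^sub>m n"
    and AU: "A = U * mat_diag n f * transpose_mat U"
  shows "proots (char_poly A) = image_mset f (mset_set {..<n})"
proof -
  have "similar_mat A (mat_diag n f)"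
    by (rule similar_matI[of _ _ U "transpose_mat U" n]) (use assms in auto)
  then have "char_poly A = char_poly (mat_diag n f)" by (rule char_poly_similar)
  also have "\<dots> = (\<Prod>a\<leftarrow>diag_mat (mat_diag n f). [:- a, 1:])"
    by (rule char_poly_upper_triangular[of _ n]) (auto simp: mat_diag_def)
  also have "diag_mat (mat_diag n f) = map f [0..<n]"
    by (auto simp: diag_mat_def mat_diag_def)
  also have "(\<Prod>a\<leftarrow>map f [0..<n]. [:- a, 1:]) = (\<Prod>i<n. [:- f i, 1:])"
    using prod.distinct_set_conv_list[of "[0..<n]" "\<lambda>i. [:- f i, 1:]"]
    by (simp add: atLeast0LessThan comp_def)
  also have "proots \<dots> = (\<Sum>i<n. proots [:- f i, 1:])"
    by (rule proots_prod) auto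
  also have "\<dots> = (\<Sum>i<n. {#f i#})" by simp
  also have "\<dots> = image_mset f (mset_set {..<n})"
    by (induction n) (auto simp: lessThan_Suc)
  finally show ?thesis .
qed

section \<open>Sums over ordered pairs of adjacent vertices\<close>

context digraph
begin

lemma finite_arcs_ends [simp]: "finite (arcs_ends G)"
  by (simp add: arcs_ends_def)

lemma arcs_ends_subset: "arcs_ends G \<subseteq> verts G \<times> verts G"
  by (auto simp: arcs_ends_conv)

lemma finite_out_neighbours [simp]: "finite {w. (v, w) \<in> arcs_ends G}"
  by (rule finite_subset[OF _ finite_verts]) (use arcs_ends_subset in auto)

lemma out_degree_eq_card_neighbours: "out_degree G v = card {w. (v, w) \<in> arcs_ends G}"
proof -
  have "bij_betw (head G) (out_arcs G v) {w. (v, w) \<in> arcs_ends G}"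
    unfolding bij_betw_def
    by (auto simp: inj_on_def arcs_ends_conv image_iff arc_to_ends_def intro: no_multi_arcs)
  then show ?thesis unfolding out_degree_def by (rule bij_betw_same_card)
qed

lemma sum_arcs_ends: "(\<Sum>v\<in>verts G. \<Sum>w | (v, w) \<in> arcs_ends G. f v w) = (\<Sum>(v,w)\<in>arcs_ends G. f v w)"
proof -
  have "arcs_ends G = Sigma (verts G) (\<lambda>v. {w. (v, w) \<in> arcs_ends G})"
    using arcs_ends_subset by auto
  then have "(\<Sum>(v,w)\<in>arcs_ends G. f v w) = (\<Sum>(v,w)\<in>Sigma (verts G) (\<lambda>v. {w. (v, w) \<in> arcs_ends G}). f v w)"
    by (rule arg_cong)
  also have "\<dots> = (\<Sum>v\<in>verts G. \<Sum>w | (v, w) \<in> arcs_ends G. f v w)"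
    by (rule sum.Sigma[symmetric]) auto
  finally show ?thesis ..
qed

end

context graph
begin

text \<open>Reversing pairs permutes the adjacency relation. This is the source of the
  self-adjointness of the Laplacian.\<close>

lemma sum_arcs_ends_swap: "(\<Sum>(v,w)\<in>arcs_ends G. f v w) = (\<Sum>(v,w)\<in>arcs_ends G. f w v)"
  by (rule sum.reindex_bij_witness[of _ prod.swap prod.swap]) (auto intro: graph_symmetric)

text \<open>The map from \<open>(a,b)\<close> to \<open>{a,b}\<close> has fibres of exactly two
  elements: symmetry supplies the second, and the absence of loops keeps them distinct.\<close>

lemma card_arcs_ends: "card (arcs_ends G) = 2 * card (undirected_edges G)"
proof -
  let ?g = "\<lambda>(a,b). {a, b}"
  have im: "undirected_edges G = ?g ` arcs_ends G"
    by (auto simp: undirected_edges_def arcs_ends_conv)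
  have "card (arcs_ends G) = (\<Sum>s\<in>?g ` arcs_ends G. card {p \<in> arcs_ends G. ?g p = s})"
    unfolding card_eq_sum by (rule sum.image_gen) simp
  also have "\<dots> = (\<Sum>s\<in>?g ` arcs_ends G. 2)"
  proof (rule sum.cong[OF refl])
    fix s assume "s \<in> ?g ` arcs_ends G"
    then obtain a b where ab: "(a,b) \<in> arcs_ends G" "s = {a,b}" by auto
    then have "{p \<in> arcs_ends G. ?g p = s} = {(a,b), (b,a)}"
      using graph_symmetric by (auto simp: doubleton_eq_iff)
    moreover have "a \<noteq> b" using ab adj_not_same by auto
    ultimately show "card {p \<in> arcs_ends G. ?g p = s} = 2" by simp
  qed
  finally show ?thesis by (simp add: im)
qed

text \<open>The columns of the diagonalizing matrix \<open>U\<close>, read as vertex functions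
  through the index map \<open>idx\<close>, form the basis.\<close>

lemma laplacian_eigenbasis_exists: "\<exists>\<mu> u. laplacian_eigenbasis G \<mu> u"
proof -
  define vs where "vs = vertex_enum G"
  define n where "n = card (verts G)"
  have vs: "distinct vs" "set vs = verts G" unfolding vs_def using vertex_enum[OF finite_verts] by auto
  have len: "length vs = n" using vs by (simp add: n_def distinct_card[symmetric])
  have bij: "bij_betw ((!) vs) {..<n} (verts G)"
    using vs by (intro bij_betw_nth) (auto simp: len)
  define idx where "idx = the_inv_into {..<n} ((!) vs)"
  have idx: "idx (vs ! k) = k" if "k < n" for k
    unfolding idx_def using that bij by (simp add: the_inv_into_f_f bij_betw_def)
  have idxn: "idx v < n" "vs ! idx v = v" if "v \<in> verts G" for v
    using that bij f_the_inv_into_f[of "(!) vs" "{..<n}" v] the_inv_into_into[of "(!) vs" "{..<n}" v]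
    by (auto simp: idx_def bij_betw_def)
  have sumV: "(\<Sum>v\<in>verts G. h v) = (\<Sum>k<n. h (vs ! k))" for h :: "'a \<Rightarrow> real"
    using sum.reindex_bij_betw[OF bij] by metis
  let ?L = "laplacian_matrix G vs"
  have L: "?L \<in> carrier_mat n n"
    unfolding laplacian_matrix_def adjacency_matrix_def len by (rule minus_carrier_mat) simp
  have "transpose_mat ?L = ?L"
    by (rule eq_matI) (auto simp: laplacian_matrix_def degree_matrix_def adjacency_matrix_def len
        dest: graph_symmetric)
  then obtain U f where U: "U \<in> carrier_mat n n" "transpose_mat U * U = 1\<^sub>m n"
      "U * transpose_mat U = 1\<^sub>m n" "?L = U * mat_diag n f * transpose_mat U"
    using real_symmetric_diagonalization[OF L] by auto
  define u where "u i v = U $$ (idx v, i)" for i v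
  have "?L * U = U * mat_diag n f * (transpose_mat U * U)"
    unfolding U(4) using U(1) by (intro assoc_mult_mat[of _ n n _ n _ n] mult_carrier_mat[of _ n n _ n]) auto
  then have LU: "?L * U = U * mat_diag n f"
    using right_mult_one_mat[OF mult_carrier_mat[OF U(1) mat_diag_dim]] by (simp add: U(2))
  have eig: "laplacian_op G (u i) v = f i * u i v" if i: "i < n" and v: "v \<in> verts G" for i v
  proof -
    define a where "a = idx v"
    have a: "a < n" "vs ! a = v" using idxn[OF v] by (auto simp: a_def)
    have "laplacian_op G (u i) v = (\<Sum>w\<in>verts G. if (v,w) \<in> arcs_ends G then u i v - u i w else 0)"
      unfolding laplacian_op_def
      by (rule sum.mono_neutral_cong_left) (use arcs_ends_subset in auto)
    also have "\<dots> = (\<Sum>w\<in>verts G. if (v,w) \<in> arcs_ends G then u i v else 0)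
        - (\<Sum>w\<in>verts G. if (v,w) \<in> arcs_ends G then u i w else 0)"
      by (subst sum_subtractf[symmetric]) (auto intro!: sum.cong)
    also have "(\<Sum>w\<in>verts G. if (v,w) \<in> arcs_ends G then u i v else 0) = degree_of G v * u i v"
    proof -
      have "(\<Sum>w\<in>verts G. if (v,w) \<in> arcs_ends G then u i v else 0) = (\<Sum>w | (v,w) \<in> arcs_ends G. u i v)"
        by (rule sum.mono_neutral_cong_right) (use arcs_ends_subset in auto)
      then show ?thesis by (simp add: out_degree_eq_card_neighbours)
    qed
    \<comment> \<open>Writing the degree term as a sum with one nonzero entry lets it merge with the
      adjacency sum into row \<open>a\<close> of the Laplacian matrix times column \<open>i\<close>
      of \<open>U\<close>.\<close>
    also have "degree_of G v * u i v = (\<Sum>k<n. if a = k then degree_of G v * u i v else 0)"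
      using a by simp
    also have "\<dots> - (\<Sum>w\<in>verts G. if (v,w) \<in> arcs_ends G then u i w else 0)
        = (\<Sum>k<n. ?L $$ (a,k) * U $$ (k,i))"
      unfolding sumV sum_subtractf[symmetric]
      using a i by (intro sum.cong)
        (auto simp: u_def idx laplacian_matrix_def degree_matrix_def adjacency_matrix_def len algebra_simps a_def)
    also have "\<dots> = (?L * U) $$ (a,i)"
      using L U(1) a i by (auto simp: scalar_prod_def lessThan_atLeast0 intro!: sum.cong)
    also have "\<dots> = U $$ (a,i) * f i"
      unfolding LU using U(1) a i by (simp add: mat_diag_mult_right)
    finally show ?thesis by (simp add: u_def[symmetric] a_def mult.commute)
  qed
  have "laplacian_eigenvalues G = image_mset f (mset_set {..<n})"
    unfolding laplacian_eigenvalues_def vs_def[symmetric]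
    by (rule proots_char_poly_orthogonally_diagonalized[OF L U])
  moreover have "(\<Sum>v\<in>verts G. u i v * u j v) = (if i = j then 1 else 0)" if "i < n" "j < n" for i j
  proof -
    have "(\<Sum>v\<in>verts G. u i v * u j v) = (transpose_mat U * U) $$ (i,j)"
      unfolding sumV using that U(1)
      by (auto simp: u_def idx scalar_prod_def lessThan_atLeast0 intro!: sum.cong)
    then show ?thesis using that by (simp add: U(2))
  qed
  moreover have "(\<Sum>i<n. u i v * u i w) = (if v = w then 1 else 0)" if "v \<in> verts G" "w \<in> verts G" for v w
  proof -
    have "(\<Sum>i<n. u i v * u i w) = (U * transpose_mat U) $$ (idx v, idx w)"
      using idxn(1)[OF that(1)] idxn(1)[OF that(2)] U(1)
      by (auto simp: u_def scalar_prod_def lessThan_atLeast0 intro!: sum.cong)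
    moreover have "idx v = idx w \<longleftrightarrow> v = w" using idxn(2) that by metis
    ultimately show ?thesis using idxn(1) that by (simp add: U(3))
  qed
  ultimately show ?thesis using eig unfolding laplacian_eigenbasis_def n_def by blast
qed

text \<open>An edge contributes \<open>x v * (x v - x w)\<close> and
  \<open>x w * (x w - x v)\<close> in its two directions, which add up to one square. The sum on the
  right meets that square twice, hence the factor 1/2.\<close>

lemma laplacian_quadratic_form:
  "(\<Sum>v\<in>verts G. x v * laplacian_op G x v) = (\<Sum>(v,w)\<in>arcs_ends G. (x v - x w)\<^sup>2) / 2"
proof -
  have "(\<Sum>v\<in>verts G. x v * laplacian_op G x v) = (\<Sum>(v,w)\<in>arcs_ends G. x v * (x v - x w))"
    unfolding laplacian_op_def sum_distrib_left by (rule sum_arcs_ends)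
  moreover have "(\<Sum>(v,w)\<in>arcs_ends G. (x v - x w)\<^sup>2)
      = (\<Sum>(v,w)\<in>arcs_ends G. x v * (x v - x w)) + (\<Sum>(v,w)\<in>arcs_ends G. x w * (x w - x v))"
    unfolding sum.distrib[symmetric] by (intro sum.cong) (auto simp: power2_eq_square algebra_simps)
  ultimately show ?thesis using sum_arcs_ends_swap[of "\<lambda>v w. x v * (x v - x w)"] by simp
qed

text \<open>As a sum of squares over arcs, the form can only grow when arcs are added. This
  transfers eigenvectors of the components to the whole tree.\<close>

lemma subgraph_laplacian_quadratic_form_le:
  assumes H: "graph H" "subgraph H G" and x: "\<And>v. v \<notin> verts H \<Longrightarrow> x v = 0"
  shows "(\<Sum>v\<in>verts H. x v * laplacian_op H x v) \<le> (\<Sum>v\<in>verts G. x v * laplacian_op G x v)"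
proof -
  interpret H: graph H by fact
  have "arcs_ends H \<subseteq> arcs_ends G" using H(2) by (rule arcs_ends_mono)
  then show ?thesis
    unfolding laplacian_quadratic_form H.laplacian_quadratic_form
    by (intro divide_right_mono sum_mono2) auto
qed

text \<open>The trace, computed in the eigenbasis: after interchanging the sums, completeness makes
  every ordered pair of adjacent vertices contribute 1 - 0.\<close>

lemma sum_laplacian_eigenvalues: "sum_mset (laplacian_eigenvalues G) = card (arcs_ends G)"
proof -
  obtain \<mu> u where "laplacian_eigenbasis G \<mu> u" using laplacian_eigenbasis_exists by blast
  note u = laplacian_eigenbasisD[OF this]
  have "sum_mset (laplacian_eigenvalues G) = (\<Sum>i<card (verts G). \<mu> i)"
    by (simp add: u(4) sum_unfold_sum_mset)
  also have "\<dots> = (\<Sum>i<card (verts G). \<Sum>v\<in>verts G. u i v * laplacian_op G (u i) v)"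
  proof (rule sum.cong[OF refl])
    fix i assume i: "i \<in> {..<card (verts G)}"
    have "(\<Sum>v\<in>verts G. u i v * laplacian_op G (u i) v) = (\<Sum>v\<in>verts G. \<mu> i * (u i v * u i v))"
      using i by (intro sum.cong) (auto simp: u(3))
    then show "\<mu> i = (\<Sum>v\<in>verts G. u i v * laplacian_op G (u i) v)"
      using i u(1)[of i i] by (simp add: sum_distrib_left[symmetric])
  qed
  also have "\<dots> = (\<Sum>i<card (verts G). \<Sum>(v,w)\<in>arcs_ends G. u i v * (u i v - u i w))"
    unfolding laplacian_op_def sum_distrib_left sum_arcs_ends ..
  also have "\<dots> = (\<Sum>p\<in>arcs_ends G. \<Sum>i<card (verts G). case p of (v,w) \<Rightarrow> u i v * (u i v - u i w))"
    by (rule sum.swap)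
  also have "\<dots> = (\<Sum>p\<in>arcs_ends G. 1)"
  proof (rule sum.cong[OF refl])
    fix p assume "p \<in> arcs_ends G"
    moreover obtain v w where p: "p = (v,w)" by fastforce
    ultimately have "v \<in> verts G" "w \<in> verts G" "v \<noteq> w"
      using arcs_ends_subset adj_not_same by auto
    then show "(\<Sum>i<card (verts G). case p of (v,w) \<Rightarrow> u i v * (u i v - u i w)) = 1"
      by (simp add: p right_diff_distrib sum_subtractf u(2))
  qed
  finally show ?thesis by simp
qed

text \<open>A variational bound in the style of Ky Fan. In the eigenbasis the left side becomes a
  combination of the deviations \<open>\<mu> i - d\<close> with weights in [0,1], hence at most the
  sum of their positive parts. The deviations sum to zero, so that sum is half the energy.\<close>

lemma sum_le_laplacian_energy:
  assumes S: "finite S" and ne: "verts G \<noteq> {}"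
    and x: "\<And>i j. i \<in> S \<Longrightarrow> j \<in> S \<Longrightarrow> (\<Sum>v\<in>verts G. x i v * x j v) = (if i = j then 1 else 0)"
  shows "2 * (\<Sum>j\<in>S. (\<Sum>v\<in>verts G. x j v * laplacian_op G (x j) v) - average_degree G)
    \<le> laplacian_energy G"
proof -
  define n where "n = card (verts G)"
  define d where "d = average_degree G"
  obtain \<mu> u where "laplacian_eigenbasis G \<mu> u" using laplacian_eigenbasis_exists by blast
  note u = laplacian_eigenbasisD[OF this]
  note u = u[folded n_def]
  define c where "c j i = (\<Sum>v\<in>verts G. u i v * x j v)" for j i
  have expand: "x j v = (\<Sum>i<n. c j i * u i v)" if "v \<in> verts G" for j v
  proof -
    have "(\<Sum>i<n. c j i * u i v) = (\<Sum>w\<in>verts G. x j w * (\<Sum>i<n. u i v * u i w))"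
      unfolding c_def sum_distrib_right sum_distrib_left
      by (subst sum.swap) (simp add: mult_ac)
    also have "\<dots> = (\<Sum>w\<in>verts G. if v = w then x j w else 0)"
      using that by (intro sum.cong) (auto simp: u(2))
    finally show ?thesis using that by simp
  qed
  have op: "laplacian_op G (x j) v = (\<Sum>i<n. c j i * \<mu> i * u i v)" if v: "v \<in> verts G" for j v
  proof -
    have "laplacian_op G (x j) v = (\<Sum>w | (v,w) \<in> arcs_ends G. \<Sum>i<n. c j i * (u i v - u i w))"
      unfolding laplacian_op_def
      by (intro sum.cong refl, subst (1 2) expand)
        (use v arcs_ends_subset in \<open>auto simp: right_diff_distrib sum_subtractf\<close>)
    also have "\<dots> = (\<Sum>i<n. c j i * laplacian_op G (u i) v)"
      unfolding laplacian_op_def sum_distrib_left by (rule sum.swap)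
    finally show ?thesis using v by (simp add: u(3) mult.assoc)
  qed
  have quad: "(\<Sum>v\<in>verts G. x j v * laplacian_op G (x j) v) = (\<Sum>i<n. \<mu> i * (c j i)\<^sup>2)" for j
  proof -
    have "(\<Sum>v\<in>verts G. x j v * laplacian_op G (x j) v)
        = (\<Sum>v\<in>verts G. \<Sum>i<n. c j i * \<mu> i * (u i v * x j v))"
      by (intro sum.cong refl) (simp add: op sum_distrib_left mult_ac)
    also have "\<dots> = (\<Sum>i<n. c j i * \<mu> i * c j i)"
      by (subst sum.swap) (simp add: c_def sum_distrib_left)
    finally show ?thesis by (simp add: power2_eq_square mult_ac)
  qed
  have parseval: "(\<Sum>i<n. (c j i)\<^sup>2) = 1" if "j \<in> S" for j
  proof -
    have "(\<Sum>v\<in>verts G. x j v * x j v) = (\<Sum>v\<in>verts G. \<Sum>i<n. c j i * (u i v * x j v))"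
      by (intro sum.cong refl, subst expand) (simp_all add: sum_distrib_left mult_ac)
    also have "\<dots> = (\<Sum>i<n. c j i * c j i)"
      by (subst sum.swap) (simp add: c_def sum_distrib_left)
    finally show ?thesis using x[OF that that] by (simp add: power2_eq_square)
  qed
  \<comment> \<open>The function \<open>y\<close> below is the projection of \<open>u i\<close> onto
    the span of the \<open>x j\<close>; the inequality is the nonnegativity of the squared norm of
    \<open>u i - y\<close>.\<close>
  have bessel: "(\<Sum>j\<in>S. (c j i)\<^sup>2) \<le> 1" if i: "i < n" for i
  proof -
    define y where "y v = (\<Sum>j\<in>S. c j i * x j v)" for v
    have uy: "(\<Sum>v\<in>verts G. u i v * y v) = (\<Sum>j\<in>S. (c j i)\<^sup>2)"
      unfolding y_def sum_distrib_left
      by (subst sum.swap) (simp add: c_def power2_eq_square sum_distrib_left mult_ac)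
    have "(\<Sum>v\<in>verts G. y v * y v) = (\<Sum>v\<in>verts G. \<Sum>j\<in>S. \<Sum>k\<in>S. c j i * c k i * (x j v * x k v))"
      unfolding y_def sum_product by (simp add: mult_ac)
    also have "\<dots> = (\<Sum>j\<in>S. \<Sum>k\<in>S. c j i * c k i * (\<Sum>v\<in>verts G. x j v * x k v))"
      by (subst sum.swap, intro sum.cong refl, subst sum.swap) (simp add: sum_distrib_left)
    also have "\<dots> = (\<Sum>j\<in>S. \<Sum>k\<in>S. if j = k then (c j i)\<^sup>2 else 0)"
      by (intro sum.cong refl) (auto simp: x power2_eq_square)
    also have "\<dots> = (\<Sum>j\<in>S. (c j i)\<^sup>2)" using S by simp
    finally have yy: "(\<Sum>v\<in>verts G. y v * y v) = (\<Sum>j\<in>S. (c j i)\<^sup>2)" .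
    have "0 \<le> (\<Sum>v\<in>verts G. (u i v - y v)\<^sup>2)" by (intro sum_nonneg) simp
    also have "\<dots> = (\<Sum>v\<in>verts G. u i v * u i v) - 2 * (\<Sum>v\<in>verts G. u i v * y v) + (\<Sum>v\<in>verts G. y v * y v)"
      unfolding sum_distrib_left sum_subtractf[symmetric] sum.distrib[symmetric]
      by (intro sum.cong) (auto simp: power2_eq_square algebra_simps)
    finally show ?thesis using u(1)[OF i i] by (simp add: uy yy)
  qed
  have "(\<Sum>j\<in>S. (\<Sum>v\<in>verts G. x j v * laplacian_op G (x j) v) - d)
      = (\<Sum>j\<in>S. \<Sum>i<n. (\<mu> i - d) * (c j i)\<^sup>2)"
  proof (rule sum.cong[OF refl])
    fix j assume "j \<in> S"
    then show "(\<Sum>v\<in>verts G. x j v * laplacian_op G (x j) v) - d = (\<Sum>i<n. (\<mu> i - d) * (c j i)\<^sup>2)"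
      using parseval by (simp add: quad left_diff_distrib sum_subtractf sum_distrib_left[symmetric])
  qed
  also have "\<dots> = (\<Sum>i<n. (\<mu> i - d) * (\<Sum>j\<in>S. (c j i)\<^sup>2))"
    by (subst sum.swap) (simp add: sum_distrib_left)
  \<comment> \<open>The expression \<open>(\<bar>a\<bar> + a) / 2\<close> is the positive part of
    \<open>a\<close>, which dominates \<open>a\<close> times any weight in [0,1].\<close>
  also have "\<dots> \<le> (\<Sum>i<n. (\<bar>\<mu> i - d\<bar> + (\<mu> i - d)) / 2)"
  proof (rule sum_mono)
    fix i assume "i \<in> {..<n}"
    then have "(\<Sum>j\<in>S. (c j i)\<^sup>2) \<le> 1" "0 \<le> (\<Sum>j\<in>S. (c j i)\<^sup>2)"
      using bessel by (auto intro: sum_nonneg)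
    then show "(\<mu> i - d) * (\<Sum>j\<in>S. (c j i)\<^sup>2) \<le> (\<bar>\<mu> i - d\<bar> + (\<mu> i - d)) / 2"
      using mult_left_mono[of "\<Sum>j\<in>S. (c j i)\<^sup>2" 1 "\<mu> i - d"]
        mult_nonpos_nonneg[of "\<mu> i - d" "\<Sum>j\<in>S. (c j i)\<^sup>2"]
      by (cases "0 \<le> \<mu> i - d") auto
  qed
  also have "\<dots> = ((\<Sum>i<n. \<bar>\<mu> i - d\<bar>) + ((\<Sum>i<n. \<mu> i) - n * d)) / 2"
    by (simp add: sum_divide_distrib[symmetric] sum.distrib sum_subtractf)
  also have "(\<Sum>i<n. \<mu> i) - n * d = 0"
  proof -
    have "(\<Sum>i<n. \<mu> i) = 2 * real (card (undirected_edges G))"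
      using sum_laplacian_eigenvalues by (simp add: u(4) sum_unfold_sum_mset card_arcs_ends)
    moreover have "n \<noteq> 0" using ne by (simp add: n_def)
    ultimately show ?thesis by (simp add: d_def average_degree_def n_def)
  qed
  also have "(\<Sum>i<n. \<bar>\<mu> i - d\<bar>) = laplacian_energy G"
    by (simp add: laplacian_energy_def u(4) d_def sum_unfold_sum_mset image_mset.compositionality comp_def)
  finally show ?thesis by (simp add: d_def)
qed

text \<open>The equality case of the previous bound, reached by the eigenvectors with eigenvalue at
  least the average degree. They are extended by zero to serve as test functions on a larger
  graph.\<close>

lemma laplacian_energy_attained:
  assumes ne: "verts G \<noteq> {}"
  shows "\<exists>(S :: nat set) \<mu> x. S \<subseteq> {..<card (verts G)} \<and>
    (\<forall>i\<in>S. \<forall>j\<in>S. (\<Sum>v\<in>verts G. x i v * x j v) = (if i = j then 1 else 0)) \<and>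
    (\<forall>i v. v \<notin> verts G \<longrightarrow> x i v = 0) \<and>
    (\<forall>i\<in>S. (\<Sum>v\<in>verts G. x i v * laplacian_op G (x i) v) = \<mu> i) \<and>
    laplacian_energy G = 2 * (\<Sum>i\<in>S. \<mu> i - average_degree G)"
proof -
  define n where "n = card (verts G)"
  define d where "d = average_degree G"
  obtain \<mu> u where "laplacian_eigenbasis G \<mu> u" using laplacian_eigenbasis_exists by blast
  note u = laplacian_eigenbasisD[OF this]
  note u = u[folded n_def]
  define S where "S = {i. i < n \<and> d \<le> \<mu> i}"
  define x where "x i v = (if v \<in> verts G then u i v else 0)" for i v
  have op: "laplacian_op G (x i) v = laplacian_op G (u i) v" if "v \<in> verts G" for i v
    unfolding laplacian_op_def x_def using that arcs_ends_subset by (intro sum.cong) auto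
  have "(\<Sum>v\<in>verts G. x i v * laplacian_op G (x i) v) = \<mu> i" if "i \<in> S" for i
  proof -
    have "i < n" using that by (simp add: S_def)
    have "(\<Sum>v\<in>verts G. x i v * laplacian_op G (x i) v) = (\<Sum>v\<in>verts G. \<mu> i * (u i v * u i v))"
      using \<open>i < n\<close> by (intro sum.cong) (auto simp: op u(3) x_def)
    then show ?thesis using u(1)[OF \<open>i < n\<close> \<open>i < n\<close>] by (simp add: sum_distrib_left[symmetric])
  qed
  moreover have "laplacian_energy G = 2 * (\<Sum>i\<in>S. \<mu> i - d)"
  proof -
    have "(\<Sum>i<n. \<mu> i) = 2 * real (card (undirected_edges G))"
      using sum_laplacian_eigenvalues by (simp add: u(4) sum_unfold_sum_mset card_arcs_ends)
    moreover have "n \<noteq> 0" using ne by (simp add: n_def)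
    ultimately have 0: "(\<Sum>i<n. \<mu> i - d) = 0"
      by (simp add: sum_subtractf d_def average_degree_def n_def)
    have "laplacian_energy G = (\<Sum>i<n. \<bar>\<mu> i - d\<bar>)"
      by (simp add: laplacian_energy_def u(4) d_def sum_unfold_sum_mset image_mset.compositionality comp_def)
    \<comment> \<open>An absolute value is twice the positive part minus the number itself, and the
      subtracted deviations cancel in total.\<close>
    also have "\<dots> = (\<Sum>i<n. 2 * (if d \<le> \<mu> i then \<mu> i - d else 0)) - (\<Sum>i<n. \<mu> i - d)"
      unfolding sum_subtractf[symmetric] by (intro sum.cong) auto
    also have "\<dots> = 2 * (\<Sum>i<n. if d \<le> \<mu> i then \<mu> i - d else 0)"
      by (simp add: 0 sum_distrib_left)
    also have "(\<Sum>i<n. if d \<le> \<mu> i then \<mu> i - d else 0) = (\<Sum>i\<in>S. \<mu> i - d)"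
      by (rule sum.mono_neutral_cong_right) (auto simp: S_def)
    finally show ?thesis .
  qed
  moreover have "S \<subseteq> {..<n}" by (auto simp: S_def)
  moreover have "(\<Sum>v\<in>verts G. x i v * x j v) = (if i = j then 1 else 0)" if "i \<in> S" "j \<in> S" for i j
    using that u(1)[of i j] by (simp add: S_def x_def)
  moreover have "\<forall>i v. v \<notin> verts G \<longrightarrow> x i v = 0" by (simp add: x_def)
  ultimately show ?thesis unfolding n_def d_def by blast
qed

end

section \<open>Trees and their components after deleting an edge\<close>

text \<open>The detour through \<open>b\<close> closes the path. Nonemptiness of \<open>p\<close>
  yields length at least 3, so the cycle is not merely an arc followed by its reverse.\<close>

lemma (in graph) apath_closing_cycle:
  assumes p: "apath u p v" "p \<noteq> []" and b: "b \<notin> set (awalk_verts u p)"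
    and vb: "(v, b) \<in> arcs_ends G" and bu: "(b, u) \<in> arcs_ends G"
  shows "\<exists>q. cycle q \<and> 3 \<le> length q"
proof -
  obtain e1 where e1: "e1 \<in> arcs G" "tail G e1 = v" "head G e1 = b" using vb by auto
  obtain e2 where e2: "e2 \<in> arcs G" "tail G e2 = b" "head G e2 = u" using bu by auto
  have w: "awalk u p v" and d: "distinct (awalk_verts u p)" using p by (auto simp: apath_def)
  have w2: "awalk u (p @ [e1, e2]) u"
    using w e1 e2 by (auto simp: awalk_simps)
  have "awalk_verts u (p @ [e1, e2]) = awalk_verts u p @ [b, u]"
    using w w2 e1 e2 by (subst awalk_verts_append[OF w2]) auto
  \<comment> \<open>The start vertex reappears at the end of a closed walk, so distinctness is
    required only after dropping the first entry.\<close>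
  moreover have "\<exists>xs. awalk_verts u p = u # xs"
    using w by (cases p) (auto simp: awalk_simps)
  ultimately have "distinct (tl (awalk_verts u (p @ [e1, e2])))"
    using d b by auto
  then have "cycle (p @ [e1, e2])" using w2 by (auto simp: cycle_def)
  moreover have "3 \<le> length (p @ [e1, e2])" using p(2) by (cases p) auto
  ultimately show ?thesis by blast
qed

text \<open>A subtree is grown one vertex at a time. Connectedness provides an edge leaving
  \<open>W\<close>; acyclicity makes it the only edge from \<open>W\<close> to the new vertex, so
  each step adds exactly two ordered pairs. The clause on paths inside \<open>W\<close> is carried
  along because the acyclicity argument needs such a path.\<close>

lemma (in graph) acyclic_connected_growth:
  assumes conn: "Digraph_Component.connected G" and acyc: "\<not> (\<exists>p. cycle p \<and> 3 \<le> length p)"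
    and k: "1 \<le> k" "k \<le> card (verts G)"
  shows "\<exists>W \<subseteq> verts G. card W = k \<and> card (arcs_ends G \<inter> W \<times> W) = 2 * (k - 1) \<and>
    (\<forall>u\<in>W. \<forall>v\<in>W. \<exists>p. apath u p v \<and> set (awalk_verts u p) \<subseteq> W)"
  using k
proof (induction k rule: dec_induct)
  case base
  then obtain r where r: "r \<in> verts G" by fastforce
  have "arcs_ends G \<inter> {r} \<times> {r} = {}" using adj_not_same by auto
  then show ?case using r
    by (intro exI[of _ "{r}"]) (auto intro!: exI[of _ "[]"] simp: apath_Nil_iff)
next
  case (step m)
  then have "m \<le> card (verts G)" by simp
  from step.IH[OF this] obtain W where W: "W \<subseteq> verts G" "card W = m" "card (arcs_ends G \<inter> W \<times> W) = 2 * (m - 1)"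
    "\<And>u v. u \<in> W \<Longrightarrow> v \<in> W \<Longrightarrow> \<exists>p. apath u p v \<and> set (awalk_verts u p) \<subseteq> W"
    by blast
  have sc: "strongly_connected G"
    using conn sym_arcs symmetric_connected_imp_strongly_connected by auto
  have finW: "finite W" using W(1) finite_verts finite_subset by blast
  obtain r where r: "r \<in> W" using W(2) step.hyps by fastforce
  have "W \<noteq> verts G" using W(2) step.prems by auto
  then obtain z where z: "z \<in> verts G" "z \<notin> W" using W(1) by blast
  have "r \<rightarrow>\<^sup>* z" using sc r z W(1) by (auto simp: strongly_connected_def)
  \<comment> \<open>A walk from \<open>r\<close> in \<open>W\<close> to a vertex outside
    \<open>W\<close> must cross the boundary of \<open>W\<close> somewhere.\<close>
  then have "z \<notin> W \<Longrightarrow> \<exists>a b. a \<in> W \<and> b \<notin> W \<and> (a, b) \<in> arcs_ends G"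
    by (induction rule: reachable_induct) (use r in blast)+
  then obtain a b where ab: "a \<in> W" "b \<notin> W" "(a, b) \<in> arcs_ends G" using z by blast
  have ba: "(b, a) \<in> arcs_ends G" using ab graph_symmetric by blast
  have bV: "b \<in> verts G" using ab adj_in_verts by blast
  \<comment> \<open>A second neighbour of \<open>b\<close> in \<open>W\<close> would be joined to
    \<open>a\<close> by a nonempty path inside \<open>W\<close>, which avoids \<open>b\<close> and
    so closes to a forbidden cycle.\<close>
  have uniq: "a' = a" if a': "a' \<in> W" "(a', b) \<in> arcs_ends G" for a'
  proof (rule ccontr)
    assume "a' \<noteq> a"
    obtain p where p: "apath a p a'" "set (awalk_verts a p) \<subseteq> W" using W(4)[OF ab(1) a'(1)] by blast
    then have "p \<noteq> []" using \<open>a' \<noteq> a\<close> by (auto simp: apath_Nil_iff)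
    then show False using apath_closing_cycle[OF p(1) _ _ a'(2) ba] p(2) ab acyc by blast
  qed
  let ?W = "insert b W"
  have "arcs_ends G \<inter> ?W \<times> ?W = (arcs_ends G \<inter> W \<times> W) \<union> {(a, b), (b, a)}"
  proof -
    have "(b, b) \<notin> arcs_ends G" using adj_not_same by blast
    moreover have "w = a" if "w \<in> W" "(b, w) \<in> arcs_ends G" for w
      using uniq that graph_symmetric by blast
    ultimately show ?thesis using ab ba uniq by blast
  qed
  moreover have "card \<dots> = card (arcs_ends G \<inter> W \<times> W) + card {(a, b), (b, a)}"
    using ab finW by (intro card_Un_disjoint) auto
  moreover have "card {(a, b), (b, a)} = 2"
  proof -
    have "a \<noteq> b" using ab by blast
    then show ?thesis by simp
  qed
  ultimately have "card (arcs_ends G \<inter> ?W \<times> ?W) = 2 * (Suc m - 1)" using W(3) step.hyps by simp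
  moreover have "card ?W = Suc m" using W(2) ab finW by simp
  moreover have "\<exists>p. apath u p v \<and> set (awalk_verts u p) \<subseteq> ?W" if uv: "u \<in> ?W" "v \<in> ?W" for u v
  proof -
    consider "u = b" "v = b" | "u = b" "v \<in> W" | "u \<in> W" "v = b" | "u \<in> W" "v \<in> W" using uv by auto
    then show ?thesis
    proof cases
      case 1
      then show ?thesis using bV by (intro exI[of _ "[]"]) (auto simp: apath_Nil_iff)
    next
      case 2
      obtain e where e: "e \<in> arcs G" "tail G e = b" "head G e = a" using ba by auto
      obtain p where p: "apath a p v" "set (awalk_verts a p) \<subseteq> W" using W(4) ab 2 by blast
      then show ?thesis using e 2 ab by (intro exI[of _ "e # p"]) (auto simp: apath_Cons_iff)
    next
      case 3
      obtain e where e: "e \<in> arcs G" "tail G e = a" "head G e = b" using ab by auto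
      obtain p where p: "apath u p a" "set (awalk_verts u p) \<subseteq> W" using W(4) ab 3 by blast
      have w: "awalk u (p @ [e]) b" using p e bV by (auto simp: apath_def awalk_simps)
      have "awalk_verts u (p @ [e]) = awalk_verts u p @ [b]"
        using e by (subst awalk_verts_append[OF w]) auto
      then show ?thesis using w p 3 ab by (intro exI[of _ "p @ [e]"]) (auto simp: apath_def)
    next
      case 4
      then show ?thesis using W(4) by blast
    qed
  qed
  moreover have "?W \<subseteq> verts G" using W(1) bV by simp
  ultimately show ?case by blast
qed

lemma (in graph) card_arcs_ends_tree:
  assumes "undirected_tree G"
  shows "card (arcs_ends G) = 2 * (card (verts G) - 1)"
proof -
  have "Digraph_Component.connected G" "\<not> (\<exists>p. cycle p \<and> 3 \<le> length p)"
    using assms by (auto simp: undirected_tree_def)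
  moreover from this have "1 \<le> card (verts G)"
    by (simp add: connected_conv Suc_le_eq card_gt_0_iff)
  ultimately obtain W where W: "W \<subseteq> verts G" "card W = card (verts G)"
      "card (arcs_ends G \<inter> W \<times> W) = 2 * (card (verts G) - 1)"
    using acyclic_connected_growth[of "card (verts G)"] by blast
  then have "W = verts G" by (simp add: card_subset_eq)
  moreover have "arcs_ends G \<inter> verts G \<times> verts G = arcs_ends G" by (auto simp: arcs_ends_conv)
  ultimately show ?thesis using W by simp
qed

section \<open>Components of a symmetric digraph\<close>

lemma strongly_connected_imp_connected:
  assumes "strongly_connected G"
  shows "Digraph_Component.connected G"
proof -
  have "arcs_ends G \<subseteq> (arcs_ends G)\<^sup>s" by (auto simp: symcl_def)
  note rtrancl_on_mono[OF this subset_refl]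
  then show ?thesis
    using assms unfolding connected_conv strongly_connected_def reachable_def by blast
qed

text \<open>Additional arcs on the same vertices preserve connectedness; this is what forces maximal
  connected subgraphs to be induced.\<close>

lemma arc_mono_connected: "arc_mono Digraph_Component.connected"
  unfolding arc_mono_def
  by (metis spanning_def subgraphE wf_digraph.connected_spanning_imp_connected)

text \<open>With symmetric arcs, connectedness and strong connectedness agree on induced subgraphs.
  The identification makes the disjointness and covering properties of \<open>sccs\<close> available
  for components.\<close>

lemma (in sym_digraph) components_eq_sccs: "components G = sccs"
proof
  have sc: "strongly_connected H" if "induced_subgraph H G" "Digraph_Component.connected H" for H
  proof -
    interpret H: wf_digraph H using that(1) by (rule wf_digraphI_induced)
    show ?thesis
      by (rule H.symmetric_connected_imp_strongly_connected[OF _ that(2)])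
        (rule induced_graph_imp_symmetric[OF sym_arcs that(1)])
  qed
  show "components G \<subseteq> sccs"
  proof
    fix H assume "H \<in> components G"
    then have H: "max_subgraph Digraph_Component.connected H" by (simp add: components_def)
    then have "induced_subgraph H G"
      using arc_mono_connected by (rule induced_subgraphI_arc_mono)
    then have "strongly_connected H" using max_subgraph_prop[OF H] by (rule sc)
    then show "H \<in> sccs" unfolding sccs_altdef2
      using max_subgraph_mp[OF H strongly_connected_imp_connected] by blast
  qed
  show "sccs \<subseteq> components G"
  proof
    fix c assume c: "c \<in> sccs"
    then have cG: "induced_subgraph c G" "strongly_connected c" unfolding sccs_def by blast+
    have con: "Digraph_Component.connected c"
      using cG(2) by (rule strongly_connected_imp_connected)
    have "H = c" if H: "subgraph c H" "subgraph H G" "Digraph_Component.connected H" for H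
    proof -
      \<comment> \<open>The competitor \<open>H\<close> may fail to be induced, so maximality of
        \<open>c\<close> is applied to the induced subgraph on its vertices; the arcs of
        \<open>H\<close> are then squeezed between those of \<open>c\<close> and those of
        \<open>?K\<close>.\<close>
      let ?K = "G \<restriction> verts H"
      have K: "induced_subgraph ?K G" by (rule induced_induce) (rule subgraph_imp_subverts[OF H(2)])
      have "spanning H ?K"
        using subgraph_induce_subgraphI2[OF H(2)] by (simp add: spanning_def)
      then have "Digraph_Component.connected ?K"
        using H(3) by (rule wf_digraph.connected_spanning_imp_connected[OF wf_digraphI_induced[OF K]])
      then have "strongly_connected ?K" by (rule sc[OF K])
      then have "\<not> verts c \<subset> verts ?K" using c K unfolding sccs_def by blast
      then have "verts H = verts c" using subgraph_imp_subverts[OF H(1)] by auto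
      then have Kc: "?K = c"
        using induced_eq_verts_imp_eq[OF K cG(1)] by simp
      moreover have "subgraph H ?K" using H(2) by (rule subgraph_induce_subgraphI2)
      ultimately have "arcs H = arcs c" using H(1) by (auto simp: subgraph_def)
      then show "H = c" using \<open>verts H = verts c\<close> H(1)
        by (intro pre_digraph.equality) (auto simp: subgraph_def compatible_def)
    qed
    moreover have "subgraph c G" using cG(1) by (rule induced_imp_subgraph)
    ultimately show "c \<in> components G"
      using con unfolding components_def max_subgraph_def by blast
  qed
qed

text \<open>Deletion compares unordered endpoint pairs, so an arc and its reverse disappear together
  and symmetry survives.\<close>

lemma delete_edge_sym_subgraph:
  assumes "graph T"
  shows "sym_digraph (delete_edge T e)" "subgraph (delete_edge T e) T"
proof -
  interpret graph T by fact
  have wf: "wf_digraph (delete_edge T e)"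
    by unfold_locales (auto simp: delete_edge_def)
  then show "subgraph (delete_edge T e) T"
    using wf_digraph by (auto simp: subgraph_def delete_edge_def compatible_def)
  have "symmetric (delete_edge T e)"
    unfolding symmetric_conv
  proof
    fix a assume a: "a \<in> arcs (delete_edge T e)"
    then obtain b where "b \<in> arcs T" "tail T a = head T b" "head T a = tail T b"
      using sym_arcs by (auto simp: symmetric_conv delete_edge_def)
    moreover from this have "b \<in> arcs (delete_edge T e)"
      using a by (auto simp: delete_edge_def insert_commute)
    ultimately show "\<exists>b\<in>arcs (delete_edge T e). tail (delete_edge T e) a = head (delete_edge T e) b \<and>
        head (delete_edge T e) a = tail (delete_edge T e) b"
      by (auto simp: delete_edge_def)
  qed
  then show "sym_digraph (delete_edge T e)"
    using wf by (intro wf_digraph.sym_digraphI)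
qed

text \<open>Any cycle of a component is a cycle of \<open>T\<close>, and symmetry passes to induced
  subgraphs.\<close>

lemma component_of_delete_edge_is_tree:
  assumes T: "undirected_tree T" and H: "H \<in> components (delete_edge T e)"
  shows "undirected_tree H" "graph H" "subgraph H T"
proof -
  let ?G = "delete_edge T e"
  have gT: "graph T" using T by (simp add: undirected_tree_def)
  interpret T: graph T by fact
  interpret G: sym_digraph ?G using delete_edge_sym_subgraph[OF gT] by simp
  have Hs: "H \<in> G.sccs" using H G.components_eq_sccs by simp
  then have ind: "induced_subgraph H ?G" by auto
  then show HT: "subgraph H T"
    using delete_edge_sym_subgraph(2)[OF gT] by (auto intro: subgraph_trans induced_imp_subgraph)
  have "digraph H" using HT by (rule T.digraph_subgraph)
  then show gH: "graph H"
    using induced_graph_imp_symmetric[OF G.sym_arcs ind] by (rule digraph.graphI)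
  moreover have "Digraph_Component.connected H"
    using H by (auto simp: components_def dest: pre_digraph.max_subgraph_prop)
  moreover have "\<not> (\<exists>p. pre_digraph.cycle H p \<and> 3 \<le> length p)"
    using T T.subgraph_cycle[OF HT] by (auto simp: undirected_tree_def)
  ultimately show "undirected_tree H" by (simp add: undirected_tree_def)
qed

lemma components_delete_edge_partition:
  assumes T: "graph T" and H: "components (delete_edge T e) = {H\<^sub>1, H\<^sub>2}" "H\<^sub>1 \<noteq> H\<^sub>2"
  shows "verts H\<^sub>1 \<inter> verts H\<^sub>2 = {}" "verts H\<^sub>1 \<union> verts H\<^sub>2 = verts T"
proof -
  let ?G = "delete_edge T e"
  interpret G: sym_digraph ?G using delete_edge_sym_subgraph[OF T] by simp
  have s: "G.sccs = {H\<^sub>1, H\<^sub>2}" using H G.components_eq_sccs by simp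
  then show "verts H\<^sub>1 \<inter> verts H\<^sub>2 = {}" using G.scc_disj H(2) by blast
  have "verts (G.Union G.sccs) = verts T"
    unfolding G.graph_is_union_sccs by (simp add: delete_edge_def)
  then show "verts H\<^sub>1 \<union> verts H\<^sub>2 = verts T" by (simp add: s G.Union_def)
qed

section \<open>The energy of the path\<close>

text \<open>By completeness, some coefficient \<open>c i\<close> of the nonzero function
  \<open>x\<close> is nonzero. Self-adjointness gives \<open>m * c i = \<mu> i * c i\<close>, hence
  \<open>m = \<mu> i\<close>.\<close>

lemma (in graph) laplacian_eigenvalueI:
  assumes x: "\<And>v. v \<in> verts G \<Longrightarrow> laplacian_op G x v = m * x v" and nz: "v \<in> verts G" "x v \<noteq> 0"
  shows "m \<in># laplacian_eigenvalues G"
proof -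
  obtain \<mu> u where "laplacian_eigenbasis G \<mu> u" using laplacian_eigenbasis_exists by blast
  note u = laplacian_eigenbasisD[OF this]
  let ?n = "card (verts G)"
  define c where "c i = (\<Sum>w\<in>verts G. u i w * x w)" for i
  have "x v = (\<Sum>w\<in>verts G. if v = w then x w else 0)" using nz by simp
  also have "\<dots> = (\<Sum>w\<in>verts G. (\<Sum>i<?n. u i v * u i w) * x w)"
    by (intro sum.cong) (auto simp: u(2) nz)
  also have "\<dots> = (\<Sum>i<?n. u i v * c i)"
    unfolding c_def sum_distrib_left sum_distrib_right by (subst sum.swap) (simp add: mult_ac)
  finally have xv: "x v = (\<Sum>i<?n. u i v * c i)" .
  have "\<exists>i<?n. c i \<noteq> 0"
  proof (rule ccontr)
    assume "\<not> (\<exists>i<?n. c i \<noteq> 0)"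
    then have "(\<Sum>i<?n. u i v * c i) = 0" by (intro sum.neutral) simp
    then show False using xv nz(2) by simp
  qed
  then obtain i where i: "i < ?n" "c i \<noteq> 0" by blast
  have "m * c i = (\<Sum>w\<in>verts G. u i w * laplacian_op G x w)"
    unfolding c_def sum_distrib_left by (intro sum.cong) (auto simp: x)
  also have "\<dots> = (\<Sum>(v,w)\<in>arcs_ends G. u i v * (x v - x w))"
    unfolding laplacian_op_def sum_distrib_left by (rule sum_arcs_ends)
  also have "\<dots> = (\<Sum>(v,w)\<in>arcs_ends G. u i v * x v) - (\<Sum>(v,w)\<in>arcs_ends G. u i v * x w)"
    by (simp add: right_diff_distrib sum_subtractf case_prod_unfold)
  also have "(\<Sum>(v,w)\<in>arcs_ends G. u i v * x w) = (\<Sum>(v,w)\<in>arcs_ends G. u i w * x v)"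
    by (rule sum_arcs_ends_swap)
  also have "(\<Sum>(v,w)\<in>arcs_ends G. u i v * x v) - \<dots> = (\<Sum>(v,w)\<in>arcs_ends G. x v * (u i v - u i w))"
    by (simp add: right_diff_distrib sum_subtractf case_prod_unfold mult.commute)
  also have "\<dots> = (\<Sum>w\<in>verts G. x w * laplacian_op G (u i) w)"
    unfolding laplacian_op_def sum_distrib_left by (rule sum_arcs_ends[symmetric])
  also have "\<dots> = \<mu> i * c i"
    unfolding c_def sum_distrib_left using i by (intro sum.cong) (auto simp: u(3))
  finally have "m = \<mu> i" using i by simp
  then show ?thesis using i by (simp add: u(4))
qed

text \<open>As many distinct eigenvalues as vertices leave no room for further ones or for
  multiplicities.\<close>

lemma (in graph) laplacian_eigenvalues_eqI:
  assumes "finite M" "card M = card (verts G)" "\<And>m. m \<in> M \<Longrightarrow> m \<in># laplacian_eigenvalues G"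
  shows "laplacian_eigenvalues G = mset_set M"
proof -
  obtain \<mu> u where "laplacian_eigenbasis G \<mu> u" using laplacian_eigenbasis_exists by blast
  note u = laplacian_eigenbasisD[OF this]
  have "mset_set M \<subseteq># laplacian_eigenvalues G"
    using assms(1,3) by (intro mset_subset_eqI) (simp add: count_mset_set' Suc_le_eq)
  then obtain K where K: "laplacian_eigenvalues G = mset_set M + K"
    by (auto simp: mset_subset_eq_exists_conv)
  have "size (laplacian_eigenvalues G) = size (mset_set M)" by (simp add: u(4) assms(2))
  then show ?thesis by (simp add: K)
qed

lemma arcs_ends_path_graph:
  "arcs_ends (path_graph n) = {(i, j). i < n \<and> j < n \<and> (j = Suc i \<or> i = Suc j)}"
  by (auto simp: arcs_ends_conv path_graph_def)

lemma graph_path_graph: "graph (path_graph n)"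
proof
  have "arcs (path_graph n) \<subseteq> {..<n} \<times> {..<n}" by (auto simp: path_graph_def)
  then show "finite (arcs (path_graph n))" by (rule finite_subset) simp
  show "symmetric (path_graph n)"
    by (auto simp: symmetric_def arcs_ends_path_graph sym_def)
qed (auto simp: path_graph_def arc_to_ends_def)

text \<open>The boundary conditions place phantom vertices at -1 and \<open>n\<close> carrying the
  value of the adjacent end vertex. Their difference terms vanish, so the three-term formula holds
  at the ends too.\<close>

lemma laplacian_op_path_graph:
  fixes f :: "real \<Rightarrow> real"
  assumes v: "v < n" and ends: "f (-1) = f 0" "f (real n) = f (real n - 1)"
  shows "laplacian_op (path_graph n) (\<lambda>i. f (real i)) v = 2 * f v - f (real v - 1) - f (real v + 1)"
proof -
  have nb: "{w. (v, w) \<in> arcs_ends (path_graph n)} = {w. w = Suc v \<and> w < n} \<union> {w. v = Suc w}"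
    using v by (auto simp: arcs_ends_path_graph)
  have "laplacian_op (path_graph n) (\<lambda>i. f (real i)) v =
      (\<Sum>w | w = Suc v \<and> w < n. f v - f (real w)) + (\<Sum>w | v = Suc w. f v - f (real w))"
    unfolding laplacian_op_def nb
    by (rule sum.union_disjoint) (auto intro: finite_subset[of _ "{..v}"])
  also have "(\<Sum>w | w = Suc v \<and> w < n. f v - f (real w)) = f v - f (real v + 1)"
  proof (cases "Suc v < n")
    case True
    then have "{w. w = Suc v \<and> w < n} = {Suc v}" by auto
    then show ?thesis by (simp add: add.commute)
  next
    case False
    then have "n = Suc v" "{w. w = Suc v \<and> w < n} = {}" using v by auto
    then show ?thesis using ends by (simp add: add.commute)
  qed
  also have "(\<Sum>w | v = Suc w. f v - f (real w)) = f v - f (real v - 1)"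
    by (cases v) (auto simp: ends)
  finally show ?thesis by simp
qed

lemma laplacian_eigenvalues_path_graph:
  assumes n: "0 < n"
  shows "laplacian_eigenvalues (path_graph n) = image_mset (\<lambda>j. 2 - 2 * cos (pi * real j / real n)) (mset_set {..<n})"
proof -
  interpret graph "path_graph n" by (rule graph_path_graph)
  let ?\<mu> = "\<lambda>j. 2 - 2 * cos (pi * real j / real n)"
  \<comment> \<open>The angles lie in [0,pi], where cosine is injective; the \<open>n\<close>
    eigenvalues are therefore distinct and exhaust the spectrum.\<close>
  have inj: "inj_on ?\<mu> {..<n}"
  proof (rule inj_onI)
    fix i j assume ij: "i \<in> {..<n}" "j \<in> {..<n}" "?\<mu> i = ?\<mu> j"
    have "cos (pi * real i / real n) = cos (pi * real j / real n)" using ij(3) by linarith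
    moreover have "0 \<le> pi * real k / real n" "pi * real k / real n \<le> pi" if "k < n" for k
      using that n by (simp_all add: divide_le_eq)
    ultimately have "pi * real i / real n = pi * real j / real n"
      using ij(1,2) by (metis cos_inj_pi lessThan_iff)
    then show "i = j" using n by (simp add: divide_cancel_right)
  qed
  have "laplacian_eigenvalues (path_graph n) = mset_set (?\<mu> ` {..<n})"
  proof (rule laplacian_eigenvalues_eqI)
    show "card (?\<mu> ` {..<n}) = card (verts (path_graph n))"
      using card_image[OF inj] by (simp add: path_graph_def)
    fix m assume "m \<in> ?\<mu> ` {..<n}"
    then obtain j where j: "j < n" "m = ?\<mu> j" by auto
    define t where "t = pi * real j / real n"
    \<comment> \<open>The shift by 1/2 makes \<open>f\<close> symmetric about -1/2 and, because
      \<open>t * real n\<close> is a multiple of pi, about n - 1/2. These are exactly the boundary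
      conditions.\<close>
    define f where "f y = cos (t * (y + 1/2))" for y
    have tn: "t * real n = pi * real j" using n by (simp add: t_def)
    have e1: "f (-1) = f 0" by (simp add: f_def)
    have a: "t * (real n + 1/2) = real j * pi + t / 2" "t * (real n - 1 + 1/2) = real j * pi - t / 2"
      using tn by (simp_all add: distrib_left right_diff_distrib mult.commute[of _ pi])
    have e2: "f (real n) = f (real n - 1)"
      unfolding f_def a cos_add cos_diff by simp
    have "laplacian_op (path_graph n) (\<lambda>i. f (real i)) v = m * f (real v)" if "v \<in> verts (path_graph n)" for v
    proof -
      have "v < n" using that by (simp add: path_graph_def)
      have b: "t * (real v - 1 + 1/2) = t * (real v + 1/2) - t" "t * (real v + 1 + 1/2) = t * (real v + 1/2) + t"
        by (simp_all add: algebra_simps)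
      have "f (real v - 1) + f (real v + 1) = 2 * cos t * f (real v)"
        unfolding f_def b cos_add cos_diff by simp
      moreover have "laplacian_op (path_graph n) (\<lambda>i. f (real i)) v = 2 * f v - f (real v - 1) - f (real v + 1)"
        using \<open>v < n\<close> e1 e2 by (rule laplacian_op_path_graph)
      moreover have "m = 2 - 2 * cos t" using j by (simp add: t_def)
      ultimately show ?thesis by (simp add: left_diff_distrib)
    qed
    moreover have "f (real 0) \<noteq> 0"
    proof -
      have "0 \<le> t / 2" "t / 2 < pi / 2" using j n by (simp_all add: t_def divide_less_eq)
      then have "0 < cos (t / 2)" using pi_gt_zero by (intro cos_gt_zero_pi) linarith+
      then show ?thesis by (simp add: f_def)
    qed
    moreover have "0 \<in> verts (path_graph n)" using n by (simp add: path_graph_def)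
    ultimately show "m \<in># laplacian_eigenvalues (path_graph n)"
      by (intro laplacian_eigenvalueI[of "\<lambda>i. f (real i)" m 0])
  qed simp
  also have "\<dots> = image_mset ?\<mu> (mset_set {..<n})" by (rule image_mset_mset_set[OF inj, symmetric])
  finally show ?thesis .
qed

text \<open>The sum telescopes: \<open>2 * sin s * cos (2 * s * j)\<close> is the difference of the
  sines at \<open>(2 * j + 1) * s\<close> and \<open>(2 * j - 1) * s\<close>, and the lower end
  contributes \<open>sin s\<close>.\<close>

lemma sum_cos_multiples:
  "sin s * (\<Sum>j<J. 2 * cos (2 * s * real j)) = sin ((2 * real J - 1) * s) + sin s" for s :: real
proof (induction J)
  case (Suc J)
  have "sin ((2 * real (Suc J) - 1) * s) - sin ((2 * real J - 1) * s)
      = sin (2 * s * real J + s) - sin (2 * s * real J - s)"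
    by (simp add: algebra_simps)
  also have "\<dots> = sin s * (2 * cos (2 * s * real J))"
    by (simp add: sin_add sin_diff)
  finally show ?case using Suc by (simp add: distrib_left)
qed simp

lemma sin_ge_cubic: "0 \<le> x \<Longrightarrow> x - x ^ 3 / 6 \<le> sin x" for x :: real
proof -
  assume "0 \<le> x"
  have "\<bar>sin x - (\<Sum>m<3. sin_coeff m * x ^ m)\<bar> \<le> inverse (fact 3) * \<bar>x\<bar> ^ 3"
    by (rule Maclaurin_sin_bound)
  moreover have "(\<Sum>m<3. sin_coeff m * x ^ m) = x"
    by (simp add: numeral_3_eq_3 sin_coeff_def)
  ultimately have "\<bar>sin x - x\<bar> \<le> x ^ 3 / 6"
    using \<open>0 \<le> x\<close> by (simp add: fact_numeral field_simps)
  then show ?thesis by linarith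
qed

text \<open>The difference of the two sides vanishes at 0 and has derivative
  \<open>y * sin y\<close>. The bound settles paths of even order.\<close>

lemma mult_cos_le_sin: "0 \<le> x \<Longrightarrow> x \<le> pi \<Longrightarrow> x * cos x \<le> sin x" for x :: real
proof -
  assume x: "0 \<le> x" "x \<le> pi"
  have "sin 0 - 0 * cos 0 \<le> sin x - x * cos x"
  proof (rule DERIV_nonneg_imp_nondecreasing[of 0 x "\<lambda>y. sin y - y * cos y"])
    fix y assume y: "0 \<le> y" "y \<le> x"
    have "((\<lambda>y. sin y - y * cos y) has_real_derivative y * sin y) (at y)"
      by (auto intro!: derivative_eq_intros)
    moreover have "0 \<le> y * sin y" using x y by (intro mult_nonneg_nonneg sin_ge_zero) auto
    ultimately show "\<exists>d. ((\<lambda>y. sin y - y * cos y) has_real_derivative d) (at y) \<and> 0 \<le> d" by blast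
  qed (use x in simp)
  then show ?thesis by simp
qed

text \<open>The first \<open>J\<close> eigenvalues do not exceed the average degree and the others
  do, so the absolute values resolve, and the telescoped cosine sum gives a closed form. It is
  compared with \<open>2 / s = 4 * n / pi\<close> separately for each parity of
  \<open>n\<close>.\<close>

lemma laplacian_energy_path_graph_le:
  assumes n: "2 \<le> n"
  shows "laplacian_energy (path_graph n) \<le> 4 * real n / pi"
proof -
  interpret graph "path_graph n" by (rule graph_path_graph)
  define s where "s = pi / (2 * real n)"
  define c where "c j = cos (2 * s * real j)" for j
  \<comment> \<open>Half of \<open>n\<close> rounded up, that is, the number of indices
    \<open>j\<close> with \<open>2 * j < n\<close>.\<close>
  define J where "J = (n + 1) div 2"
  have s: "0 < s" "s \<le> pi / 4" using n by (auto simp: s_def field_simps)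
  have s1: "s \<le> 1" using s pi_less_4 by linarith
  have ns: "1 / real n = 2 * s / pi" using n by (simp add: s_def)
  have sin_s: "0 < sin s" using s pi_gt_zero by (intro sin_gt_zero) linarith+
  have theta: "pi * real j / real n = 2 * s * real j" for j using n by (simp add: s_def)
  have "s ^ 2 \<le> 1" using s s1 by (simp add: power_le_one)
  then have cub: "s * (5/6) \<le> s - s ^ 3 / 6"
    using s mult_left_mono[of "s ^ 2" 1 s] by (simp add: power3_eq_cube power2_eq_square)
  \<comment> \<open>A crude lower bound on pi, from \<open>sin x \<le> x\<close> at
    \<open>pi / 4\<close>; 12/5 is the value at which \<open>2 / pi\<close> equals the factor 5/6 of
    \<open>cub\<close>.\<close>
  have "7/5 \<le> sqrt 2" by (rule real_le_rsqrt) (simp add: power2_eq_square)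
  moreover have "sqrt 2 / 2 \<le> pi / 4" using sin_x_le_x[of "pi / 4"] by (simp add: sin_45)
  ultimately have "12/5 \<le> pi" by linarith
  then have "2 / pi \<le> 5/6" by (simp add: field_simps)
  then have "s * (2 / pi) \<le> s * (5/6)" using s by (intro mult_left_mono) auto
  \<comment> \<open>Jordan's inequality at \<open>s\<close>. It places the threshold
    \<open>1 / n\<close> below \<open>cos (pi / 2 - s) = sin s\<close>, which bounds every
    \<open>c j\<close> with \<open>j < J\<close> from below.\<close>
  then have jordan: "1 / real n \<le> sin s" using cub sin_ge_cubic[of s] s ns by simp
  have eig: "laplacian_eigenvalues (path_graph n) = image_mset (\<lambda>j. 2 - 2 * c j) (mset_set {..<n})"
    using laplacian_eigenvalues_path_graph[of n] n by (simp add: theta c_def)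
  have sum_n: "(\<Sum>j<n. 2 * c j) = 2"
  proof -
    have "(2 * real n - 1) * s = pi - s" using n by (simp add: s_def field_simps)
    then have "sin s * (\<Sum>j<n. 2 * c j) = sin s * 2" using sum_cos_multiples[of s n] by (simp add: c_def)
    then show ?thesis using sin_s by (simp del: sum_distrib_left)
  qed
  have "2 * real (card (undirected_edges (path_graph n))) = sum_mset (laplacian_eigenvalues (path_graph n))"
    by (simp add: sum_laplacian_eigenvalues card_arcs_ends)
  also have "\<dots> = 2 * real n - 2"
    using sum_n by (simp add: eig sum_unfold_sum_mset[symmetric] sum_subtractf)
  finally have avg: "average_degree (path_graph n) = 2 - 2 / real n"
    using n by (simp add: average_degree_def path_graph_def field_simps)
  have "laplacian_energy (path_graph n) = (\<Sum>j<n. \<bar>2 - 2 * c j - (2 - 2 / real n)\<bar>)"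
    by (simp add: laplacian_energy_def eig avg sum_unfold_sum_mset image_mset.compositionality comp_def)
  \<comment> \<open>For \<open>j < J\<close> the sign flips, expressed as the deviation minus twice
    itself; the unflipped deviations sum to zero by \<open>sum_n\<close>.\<close>
  also have "\<dots> = (\<Sum>j<n. (2 / real n - 2 * c j) + (if j < J then 2 * (2 * c j) - 4 / real n else 0))"
  proof (rule sum.cong[OF refl])
    fix j assume "j \<in> {..<n}"
    then have j: "j < n" by simp
    show "\<bar>2 - 2 * c j - (2 - 2 / real n)\<bar>
        = (2 / real n - 2 * c j) + (if j < J then 2 * (2 * c j) - 4 / real n else 0)"
    proof (cases "j < J")
      case True
      then have "2 * real j + 1 \<le> real n" unfolding J_def by linarith
      then have "s * (2 * real j + 1) \<le> s * real n" using s by (intro mult_left_mono) auto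
      moreover have "s * real n = pi / 2" using n by (simp add: s_def)
      ultimately have "2 * s * real j \<le> pi / 2 - s" by (simp add: algebra_simps)
      then have "cos (pi / 2 - s) \<le> c j"
        unfolding c_def using s by (intro cos_monotone_0_pi_le) auto
      then have "1 / real n \<le> c j" using jordan by (simp add: cos_diff)
      then show ?thesis using True by simp
    next
      case False
      then have "real n \<le> 2 * real j" unfolding J_def by linarith
      then have "s * real n \<le> s * (2 * real j)" using s by (intro mult_left_mono) auto
      moreover have "s * real n = pi / 2" using n by (simp add: s_def)
      ultimately have "pi / 2 \<le> 2 * s * real j" by (simp add: algebra_simps)
      moreover have "2 * s * real j \<le> pi" using j n by (simp add: s_def field_simps)
      ultimately have "c j \<le> cos (pi / 2)"
        unfolding c_def by (intro cos_monotone_0_pi_le) auto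
      then have "c j \<le> 0" by simp
      moreover have "0 \<le> 2 / real n" by simp
      ultimately have "0 \<le> 2 / real n - 2 * c j" by linarith
      then show ?thesis using False by simp
    qed
  qed
  also have "\<dots> = 2 - (\<Sum>j<n. 2 * c j) + (\<Sum>j<J. 2 * (2 * c j) - 4 / real n)"
  proof -
    have "(\<Sum>j<n. if j < J then 2 * (2 * c j) - 4 / real n else 0) = (\<Sum>j<J. 2 * (2 * c j) - 4 / real n)"
      by (rule sum.mono_neutral_cong_right) (use n in \<open>auto simp: J_def\<close>)
    then show ?thesis using n by (simp add: sum.distrib sum_subtractf)
  qed
  also have "\<dots> = 2 * (\<Sum>j<J. 2 * c j) - 4 * real J / real n"
    by (simp add: sum_n sum_subtractf sum_distrib_left)
  also have "(\<Sum>j<J. 2 * c j) = sin ((2 * real J - 1) * s) / sin s + 1"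
    using sum_cos_multiples[of s J] sin_s by (simp add: c_def field_simps)
  finally have energy: "laplacian_energy (path_graph n)
      = 2 * (sin ((2 * real J - 1) * s) / sin s + 1) - 4 * real J / real n" .
  have inv_s: "4 * real n / pi = 2 / s" using n by (simp add: s_def)
  show ?thesis
  proof (cases "even n")
    case True
    then obtain k where "n = 2 * k" by (elim evenE)
    then have J: "2 * real J = real n" by (simp add: J_def)
    have h: "(2 * real J - 1) * s = pi / 2 - s" unfolding J using n by (simp add: s_def field_simps)
    have "laplacian_energy (path_graph n) = 2 * (cos s / sin s) + 2 - 2 * (2 * real J) / real n"
      unfolding energy h by (simp add: sin_diff)
    also have "\<dots> = 2 * (cos s / sin s)" unfolding J using n by simp
    also have "\<dots> \<le> 2 / s"
      using mult_cos_le_sin[of s] s s1 sin_s pi_ge_two by (simp add: field_simps)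
    finally show ?thesis by (simp add: inv_s)
  next
    case False
    then have J: "2 * real J = real n + 1" unfolding J_def by (auto elim!: oddE)
    have h: "(2 * real J - 1) * s = pi / 2" unfolding J using n by (simp add: s_def field_simps)
    have "laplacian_energy (path_graph n) = 2 * (1 / sin s) + 2 - 2 * (2 * real J) / real n"
      unfolding energy h by simp
    also have "\<dots> = 2 * (1 / sin s - 2 * s / pi)" using n by (simp add: J add_divide_distrib ns[symmetric])
    \<comment> \<open>The coefficient 1/5 exceeds the 1/6 of the cubic bound, which leaves the
      surplus \<open>s ^ 2 * (1 - s ^ 2) / 30\<close>, nonnegative since \<open>s \<le> 1\<close>.
      The extra \<open>s / 5\<close> is then absorbed by \<open>2 * s / pi\<close>, which is the
      term \<open>1 / n\<close>.\<close>
    also have "1 / sin s \<le> 1 / s + s / 5"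
    proof -
      have "1 / sin s \<le> 1 / (s - s ^ 3 / 6)"
        using sin_ge_cubic[of s] cub s by (intro divide_left_mono) auto
      also have "\<dots> \<le> 1 / s + s / 5"
      proof -
        have "1 \<le> (1 / s + s / 5) * (s - s ^ 3 / 6)"
        proof -
          have "(1 / s + s / 5) * (s - s ^ 3 / 6) = 1 + s ^ 2 * (1 - s ^ 2) / 30"
            using s by (simp add: field_simps power_def numeral_eq_Suc)
          then show ?thesis using \<open>s ^ 2 \<le> 1\<close> by simp
        qed
        then show ?thesis using cub s by (simp add: divide_le_eq)
      qed
      finally show ?thesis .
    qed
    also have "s / 5 \<le> 2 * s / pi" using s pi_less_4 by (simp add: field_simps)
    finally show ?thesis by (simp add: inv_s)
  qed
qed

section \<open>Comparison of the energies\<close>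

lemma average_degree_tree:
  assumes "undirected_tree G"
  shows "average_degree G = 2 - 2 / real (card (verts G))" and "0 < card (verts G)"
proof -
  interpret graph G using assms by (simp add: undirected_tree_def)
  have ne: "verts G \<noteq> {}" using assms by (simp add: undirected_tree_def connected_conv)
  then show pos: "0 < card (verts G)" by (simp add: card_gt_0_iff)
  have "card (undirected_edges G) = card (verts G) - 1"
    using card_arcs_ends card_arcs_ends_tree[OF assms] by simp
  then have "real (card (undirected_edges G)) = real (card (verts G)) - 1"
    using pos by linarith
  then show "average_degree G = 2 - 2 / real (card (verts G))"
    using ne by (simp add: average_degree_def right_diff_distrib diff_divide_distrib)
qed

text \<open>Optimal families for the two components, extended by zero, are jointly orthonormal on
  \<open>T\<close> because their supports are disjoint. The loss of 4 comes only from replacing the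
  average degrees of the components by that of \<open>T\<close>.\<close>

lemma laplacian_energy_ge_delete_edge_components:
  assumes T: "undirected_tree T"
    and comp: "components (delete_edge T e) = {T\<^sub>1, T\<^sub>2}" "T\<^sub>1 \<noteq> T\<^sub>2"
  shows "laplacian_energy T\<^sub>1 + laplacian_energy T\<^sub>2 - 4 \<le> laplacian_energy T"
proof -
  interpret T: graph T using T by (simp add: undirected_tree_def)
  have "T\<^sub>1 \<in> components (delete_edge T e)" "T\<^sub>2 \<in> components (delete_edge T e)" using comp by auto
  note t1 = component_of_delete_edge_is_tree[OF T this(1)]
    and t2 = component_of_delete_edge_is_tree[OF T this(2)]
  interpret T1: graph T\<^sub>1 by (rule t1)
  interpret T2: graph T\<^sub>2 by (rule t2)
  note part = components_delete_edge_partition[OF T.graph_axioms comp]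
  note a = average_degree_tree[OF T] and a1 = average_degree_tree[OF t1(1)]
    and a2 = average_degree_tree[OF t2(1)]
  define n n1 n2 where "n = card (verts T)" and "n1 = card (verts T\<^sub>1)" and "n2 = card (verts T\<^sub>2)"
  note n_defs = n_def n1_def n2_def
  have n: "n = n1 + n2" "0 < n1" "0 < n2"
    using card_Un_disjoint[OF T1.finite_verts T2.finite_verts part(1)] a1(2) a2(2)
    unfolding n_defs part(2) by simp_all
  then have n_le: "n1 \<le> n" "n2 \<le> n" by simp_all
  define d where "d = average_degree T"
  have ne: "verts T\<^sub>1 \<noteq> {}" "verts T\<^sub>2 \<noteq> {}" "verts T \<noteq> {}" using a(2) a1(2) a2(2) by auto
  obtain S1 \<mu>1 x1 where "S1 \<subseteq> {..<n1}"
    "\<forall>i\<in>S1. \<forall>j\<in>S1. (\<Sum>v\<in>verts T\<^sub>1. x1 i v * x1 j v) = (if i = j then 1 else 0)"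
    "\<forall>i v. v \<notin> verts T\<^sub>1 \<longrightarrow> x1 i v = 0"
    "\<forall>i\<in>S1. (\<Sum>v\<in>verts T\<^sub>1. x1 i v * laplacian_op T\<^sub>1 (x1 i) v) = \<mu>1 i"
    "laplacian_energy T\<^sub>1 = 2 * (\<Sum>i\<in>S1. \<mu>1 i - average_degree T\<^sub>1)"
    using T1.laplacian_energy_attained[OF ne(1)] unfolding n1_def by (elim exE conjE)
  note S1 = this[rule_format]
  obtain S2 \<mu>2 x2 where "S2 \<subseteq> {..<n2}"
    "\<forall>i\<in>S2. \<forall>j\<in>S2. (\<Sum>v\<in>verts T\<^sub>2. x2 i v * x2 j v) = (if i = j then 1 else 0)"
    "\<forall>i v. v \<notin> verts T\<^sub>2 \<longrightarrow> x2 i v = 0"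
    "\<forall>i\<in>S2. (\<Sum>v\<in>verts T\<^sub>2. x2 i v * laplacian_op T\<^sub>2 (x2 i) v) = \<mu>2 i"
    "laplacian_energy T\<^sub>2 = 2 * (\<Sum>i\<in>S2. \<mu>2 i - average_degree T\<^sub>2)"
    using T2.laplacian_energy_attained[OF ne(2)] unfolding n2_def by (elim exE conjE)
  note S2 = this[rule_format]
  have fin: "finite S1" "finite S2" using S1(1) S2(1) finite_subset by blast+
  have restrict: "(\<Sum>v\<in>verts T. f v * g v) = (\<Sum>v\<in>V. f v * g v)"
    if "V \<subseteq> verts T" "\<And>v. v \<notin> V \<Longrightarrow> f v = 0" for V and f g :: "'a \<Rightarrow> real"
    by (rule sum.mono_neutral_right) (use that in auto)
  have disj: "x1 i v = 0 \<or> x2 j v = 0" for i j v using part(1) S1(3) S2(3) by blast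
  have zero: "x1 i v * x2 j v = 0" "x2 j v * x1 i v = 0" for i j v using disj[of i v j] by auto
  have cross: "(\<Sum>v\<in>verts T. x1 i v * x2 j v) = 0" "(\<Sum>v\<in>verts T. x2 j v * x1 i v) = 0" for i j
    by (simp_all add: zero)
  \<comment> \<open>The disjoint sum \<open>S1 <+> S2\<close> keeps the index sets apart, since both
    are sets of natural numbers and may overlap.\<close>
  define x where "x = case_sum x1 x2"
  define Q where "Q y = (\<Sum>v\<in>verts T. y v * laplacian_op T y v)" for y
  have "2 * (\<Sum>j\<in>S1 <+> S2. Q (x j) - d) \<le> laplacian_energy T"
    unfolding Q_def d_def
  proof (rule T.sum_le_laplacian_energy)
    fix i j assume "i \<in> S1 <+> S2" "j \<in> S1 <+> S2"
    then consider a b where "i = Inl a" "j = Inl b" "a \<in> S1" "b \<in> S1"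
      | a b where "i = Inl a" "j = Inr b" | a b where "i = Inr a" "j = Inl b"
      | a b where "i = Inr a" "j = Inr b" "a \<in> S2" "b \<in> S2"
      by (elim PlusE) blast+
    then show "(\<Sum>v\<in>verts T. x i v * x j v) = (if i = j then 1 else 0)"
    proof cases
      case (1 a b)
      have "(\<Sum>v\<in>verts T. x1 a v * x1 b v) = (\<Sum>v\<in>verts T\<^sub>1. x1 a v * x1 b v)"
        by (rule restrict) (use part S1(3) in auto)
      then show ?thesis using 1 S1(2) by (simp add: x_def)
    next
      case (4 a b)
      have "(\<Sum>v\<in>verts T. x2 a v * x2 b v) = (\<Sum>v\<in>verts T\<^sub>2. x2 a v * x2 b v)"
        by (rule restrict) (use part S2(3) in auto)
      then show ?thesis using 4 S2(2) by (simp add: x_def)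
    qed (simp_all add: x_def cross)
  qed (use fin ne in auto)
  also have "(\<Sum>j\<in>S1 <+> S2. Q (x j) - d) = (\<Sum>i\<in>S1. Q (x1 i) - d) + (\<Sum>i\<in>S2. Q (x2 i) - d)"
    using fin by (simp add: sum.Plus x_def comp_def)
  finally have energy: "2 * ((\<Sum>i\<in>S1. Q (x1 i) - d) + (\<Sum>i\<in>S2. Q (x2 i) - d)) \<le> laplacian_energy T" .
  have q1: "(\<Sum>i\<in>S1. \<mu>1 i - d) \<le> (\<Sum>i\<in>S1. Q (x1 i) - d)"
  proof (intro sum_mono diff_right_mono)
    fix i assume "i \<in> S1"
    then show "\<mu>1 i \<le> Q (x1 i)"
      unfolding Q_def S1(4)[OF \<open>i \<in> S1\<close>, symmetric]
      by (intro T.subgraph_laplacian_quadratic_form_le t1 S1(3))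
  qed
  have q2: "(\<Sum>i\<in>S2. \<mu>2 i - d) \<le> (\<Sum>i\<in>S2. Q (x2 i) - d)"
  proof (intro sum_mono diff_right_mono)
    fix i assume "i \<in> S2"
    then show "\<mu>2 i \<le> Q (x2 i)"
      unfolding Q_def S2(4)[OF \<open>i \<in> S2\<close>, symmetric]
      by (intro T.subgraph_laplacian_quadratic_form_le t2 S2(3))
  qed
  \<comment> \<open>Raising the threshold from \<open>c\<close> to \<open>d\<close> costs
    \<open>2 / m - 2 / n\<close> per selected eigenvalue, of which there are at most
    \<open>m\<close>.\<close>
  have shift: "E / 2 + (2 * real m / real n - 2) \<le> (\<Sum>i\<in>S. \<mu> i - d)"
    if "S \<subseteq> {..<m}" "0 < m" "m \<le> n" "c = 2 - 2 / real m" "E = 2 * (\<Sum>i\<in>S. \<mu> i - c)"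
    for S m E c and \<mu> :: "nat \<Rightarrow> real"
  proof -
    have "card S \<le> m" using card_mono[OF _ that(1)] by simp
    moreover have "2 / real n \<le> 2 / real m" using that by (intro divide_left_mono) auto
    ultimately have "real m * (2 / real n - 2 / real m) \<le> real (card S) * (2 / real n - 2 / real m)"
      by (intro mult_right_mono_neg) auto
    moreover have "real m * (2 / real n - 2 / real m) = 2 * real m / real n - 2"
      using that by (simp add: right_diff_distrib)
    moreover have "(\<Sum>i\<in>S. \<mu> i - d) = (\<Sum>i\<in>S. \<mu> i - c) + real (card S) * (c - d)"
      by (simp add: sum_subtractf right_diff_distrib)
    moreover have "c - d = 2 / real n - 2 / real m" using a(1) that(4) by (simp add: d_def n_def)
    ultimately show ?thesis using that(5) by simp
  qed
  have "laplacian_energy T\<^sub>1 / 2 + (2 * real n1 / real n - 2)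
      + (laplacian_energy T\<^sub>2 / 2 + (2 * real n2 / real n - 2)) \<le> laplacian_energy T / 2"
    using add_mono[OF order_trans[OF shift[OF S1(1) n(2) n_le(1) a1(1)[folded n1_def] S1(5)] q1]
        order_trans[OF shift[OF S2(1) n(3) n_le(2) a2(1)[folded n2_def] S2(5)] q2]]
    by (rule order_trans) (use energy in \<open>simp only: le_divide_eq_numeral1 mult.commute\<close>)
  \<comment> \<open>The two costs together are 4 - 2 = 2 on the level of half energies, hence 4 for
    the energies.\<close>
  moreover have "2 * real n1 / real n + 2 * real n2 / real n = 2"
    using n by (simp add: add_divide_distrib[symmetric] divide_eq_eq)
  ultimately show ?thesis by simp
qed
theorem corollary3p7:
  fixes T T\<^sub>1 T\<^sub>2 :: "('a,'b) pre_digraph" and e :: 'b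
    and n n\<^sub>1 n\<^sub>2 k\<^sub>1 k\<^sub>2 \<sigma>\<^sub>1 \<sigma>\<^sub>2 :: nat
  assumes "undirected_tree T" and "n = card (verts T)" and "8 \<le> n"
    and "e \<in> arcs T" and "non_pendent T e"
    and "components (delete_edge T e) = {T\<^sub>1, T\<^sub>2}" and "T\<^sub>1 \<noteq> T\<^sub>2"
    and "n\<^sub>1 = card (verts T\<^sub>1)" and "n\<^sub>2 = card (verts T\<^sub>2)"
    and "k\<^sub>1 = num_laplacian_eigenvalues_ge T\<^sub>1 (average_degree (delete_edge T e))"
    and "k\<^sub>2 = num_laplacian_eigenvalues_ge T\<^sub>2 (average_degree (delete_edge T e))"
    and "\<sigma>\<^sub>1 = num_laplacian_eigenvalues_ge T\<^sub>1 (average_degree T\<^sub>1)"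
    and "\<sigma>\<^sub>2 = num_laplacian_eigenvalues_ge T\<^sub>2 (average_degree T\<^sub>2)"
    and "\<sigma>\<^sub>1 = k\<^sub>1" and "\<sigma>\<^sub>2 = k\<^sub>2"
    and "laplacian_energy T\<^sub>1 \<ge> 2 + 4 * real n\<^sub>1 / pi"
    and "laplacian_energy T\<^sub>2 \<ge> 2 + 4 * real n\<^sub>2 / pi"
  shows "laplacian_energy T \<ge> laplacian_energy (path_graph n)"
proof -
  have n: "n = n\<^sub>1 + n\<^sub>2"
  proof -
    have "graph T" using assms(1) by (simp add: undirected_tree_def)
    then interpret T: graph T .
    note part = components_delete_edge_partition[OF T.graph_axioms assms(6,7)]
    have "finite (verts T\<^sub>1)" "finite (verts T\<^sub>2)"
      using part(2) T.finite_verts by (metis finite_Un)+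
    then show ?thesis using part assms(2,8,9) by (simp add: card_Un_disjoint[symmetric])
  qed
  have "laplacian_energy (path_graph n) \<le> 4 * real n / pi"
    using assms(3) by (intro laplacian_energy_path_graph_le) simp
  also have "\<dots> = 4 * real n\<^sub>1 / pi + 4 * real n\<^sub>2 / pi"
    by (simp add: n distrib_left add_divide_distrib)
  \<comment> \<open>The summand 2 in each energy hypothesis pays for the total loss of 4.\<close>
  also have "\<dots> \<le> laplacian_energy T\<^sub>1 + laplacian_energy T\<^sub>2 - 4"
    using assms(16,17) by simp
  also have "\<dots> \<le> laplacian_energy T"
    using assms(1,6,7) by (rule laplacian_energy_ge_delete_edge_components)
  finally show ?thesis .
qed

end
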